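(* Let $1<p<\infty$ and $p^*=\max\left(p,\frac{p}{p-1}\right)$. For every complex-valued radial function $f\in C_0^\infty(\mathbb{C})$, i.e. every smooth compactly supported $f:\mathbb{C}\to\mathbb{C}$ with $f(z)=f(|z|)$ for all $z\in\mathbb{C}$, $$\int_{\mathbb{C}} |Tf|^p\,dx\,dy\le (p^*-1)^p\int_{\mathbb{C}}|f|^p\,dx\,dy,$$ where $T$ is the Ahlfors–Beurling operator.
   Context: For smooth functions $\varphi$ with compact support on $\mathbb{C}$ write $\partial \varphi=\varphi_x-i\varphi_y$ and $\bar\partial \varphi=\varphi_x+i\varphi_y$ (the usual factor $\frac12$ is omitted). The Ahlfors–Beurling operator $T$ is the operator that sends $\bar\partial \varphi$ to $\partial \varphi$ for all $\varphi\in C_0^\infty(\mathbb{C})$, extended to a bounded linear operator on $L^p(\mathbb{C})$, $1<p<\infty$. Up to sign (which does not affect the statement) it is the principal-value convolution operator with kernel $K(z)=\frac{1}{\pi z^2}$. *)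

theory Defs
  imports "HOL-Analysis.Analysis"
begin

text \<open>Differentiability is over the reals: \<^const>\<open>frechet_derivative\<close> of
  \<open>f :: complex \<Rightarrow> complex\<close> at a point is a real-linear map of the plane.\<close>

primrec Ck :: "nat \<Rightarrow> (complex \<Rightarrow> complex) \<Rightarrow> bool" where
  "Ck 0 f \<longleftrightarrow> continuous_on UNIV f"
| "Ck (Suc k) f \<longleftrightarrow>
     (\<forall>z. f differentiable (at z)) \<and> (\<forall>v. Ck k (\<lambda>z. frechet_derivative f (at z) v))"

definition test_function :: "(complex \<Rightarrow> complex) \<Rightarrow> bool" where
  "test_function f \<longleftrightarrow> (\<forall>k. Ck k f) \<and> compact (closure {z. f z \<noteq> 0})"

definition radial :: "(complex \<Rightarrow> complex) \<Rightarrow> bool" where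
  "radial f \<longleftrightarrow> (\<forall>z. f z = f (of_real (cmod z)))"

definition partial_x :: "(complex \<Rightarrow> complex) \<Rightarrow> complex \<Rightarrow> complex" where
  "partial_x f z = frechet_derivative f (at z) 1"

definition partial_y :: "(complex \<Rightarrow> complex) \<Rightarrow> complex \<Rightarrow> complex" where
  "partial_y f z = frechet_derivative f (at z) \<i>"

text \<open>The usual factor \<open>1/2\<close> is omitted in both operators.\<close>

definition d_op :: "(complex \<Rightarrow> complex) \<Rightarrow> complex \<Rightarrow> complex" where
  "d_op f z = partial_x f z - \<i> * partial_y f z"

definition dbar_op :: "(complex \<Rightarrow> complex) \<Rightarrow> complex \<Rightarrow> complex" where
  "dbar_op f z = partial_x f z + \<i> * partial_y f z"

definition Lp :: "real \<Rightarrow> (complex \<Rightarrow> complex) set" where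
  "Lp p = {f \<in> borel_measurable lborel. integrable lborel (\<lambda>z. cmod (f z) powr p)}"

definition Lp_norm :: "real \<Rightarrow> (complex \<Rightarrow> complex) \<Rightarrow> real" where
  "Lp_norm p f = (LINT z|lborel. cmod (f z) powr p) powr (1 / p)"

text \<open>Operators on \<open>L\<^sup>p\<close> act on representatives, and identities hold almost everywhere.
  Linearity and boundedness together force such an operator to respect almost-everywhere
  equality, so it induces a bounded operator on equivalence classes.\<close>

definition bounded_linear_Lp ::
  "real \<Rightarrow> ((complex \<Rightarrow> complex) \<Rightarrow> complex \<Rightarrow> complex) \<Rightarrow> bool" where
  "bounded_linear_Lp p T \<longleftrightarrow>
     (\<forall>f\<in>Lp p. T f \<in> Lp p) \<and>
     (\<forall>f\<in>Lp p. \<forall>g\<in>Lp p. AE z in lborel. T (\<lambda>w. f w + g w) z = T f z + T g z) \<and>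
     (\<forall>c. \<forall>f\<in>Lp p. AE z in lborel. T (\<lambda>w. c * f w) z = c * T f z) \<and>
     (\<exists>C. \<forall>f\<in>Lp p. Lp_norm p (T f) \<le> C * Lp_norm p f)"

text \<open>For \<open>1 < p < \<infinity>\<close> the functions \<open>dbar_op \<phi>\<close>, with \<open>\<phi>\<close> a test function, are dense in
  \<open>L\<^sup>p\<close>, so this determines \<open>T\<close> up to almost-everywhere equality; existence of such
  a \<open>T\<close> is the Calderon-Zygmund theorem.\<close>

definition ahlfors_beurling ::
  "real \<Rightarrow> ((complex \<Rightarrow> complex) \<Rightarrow> complex \<Rightarrow> complex) \<Rightarrow> bool" where
  "ahlfors_beurling p T \<longleftrightarrow>
     bounded_linear_Lp p T \<and>
     (\<forall>\<phi>. test_function \<phi> \<longrightarrow> (AE z in lborel. T (dbar_op \<phi>) z = d_op \<phi> z))"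

end

theory Submission
  imports Defs
begin

text \<open>
  Write \<open>E N(z) = DN(z)[z]\<close> for the Euler operator \<open>r d/dr\<close>, and \<open>p* = max p (p/(p-1))\<close>,
  \<open>k = p* - 1\<close>.

  For radial \<open>f\<close> the equation \<open>dbar \<phi> = f\<close> is solved by \<open>\<phi>(z) = cnj z * M(z)\<close> with the ray mean
  \<open>M(z) = \<integral>\<^sub>0\<^sup>1 s f(sz) ds\<close>. As \<open>M\<close> is radial, its angular derivative vanishes, which turns
  the two operators into \<open>f = dbar \<phi> = 2M + E M\<close> and \<open>\<bar>d \<phi>\<bar> = \<bar>E M\<bar>\<close>
  (\<open>ops_of_conj_times_radial\<close>, \<open>ray_mean_solves_euler\<close>). The theorem thus becomes the Hardy-type
  inequality that the \<open>L\<^sup>p\<close> norm of \<open>E M\<close> is at most \<open>k\<close> times that of \<open>2M + E M\<close>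
  (\<open>euler_op_bound\<close>).

  It follows from an elementary inequality between complex numbers (\<open>pointwise_bound\<close>): for some
  constant \<open>c\<close>,
  \<open>k\<^sup>p \<bar>m + y\<bar>\<^sup>p - \<bar>y\<bar>\<^sup>p \<ge> c (\<bar>m\<bar>\<^sup>p + p \<bar>m\<bar>\<^bsup>p-2\<^esup> Re (cnj m * y))\<close>.
  With \<open>m = 2M\<close> and \<open>y = E M\<close> the left side is what has to have a nonnegative integral, and the
  right side is \<open>c/2\<close> times \<open>2 \<bar>m\<bar>\<^sup>p + E(\<bar>m\<bar>\<^sup>p)\<close>, the divergence of the vector field
  \<open>\<bar>m(z)\<bar>\<^sup>p z\<close>. Its integral over the plane vanishes when \<open>m\<close> has compact support
  (\<open>integral_radial_divergence\<close>).

  The ray mean of \<open>f\<close> has compact support exactly when \<open>f\<close> has integral zero; in general it only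
  decays like \<open>\<bar>z\<bar>\<^bsup>-2\<^esup>\<close>. Therefore \<open>f\<close> is replaced by \<open>f(z) - l\<^sup>2 f(lz)\<close>, which has integral zero
  (\<open>radial_mean_zero_bound\<close>). The correction \<open>l\<^sup>2 f(lz)\<close> has the same integral as \<open>f\<close> but
  spreads out as \<open>l\<close> tends to \<open>0\<close>: the \<open>p\<close>-th power of its norm is \<open>l\<^bsup>2p-2\<^esup>\<close> times that of \<open>f\<close>,
  and since \<open>T\<close> is linear and bounded, the inequality passes to the limit.
\<close>

section \<open>Elementary inequalities for real powers\<close>

lemma powr_Bernoulli_ge:
  fixes x q :: real
  assumes "1 \<le> q" "-1 \<le> x"
  shows "1 + q * x \<le> (1 + x) powr q"
proof (cases "x = -1")
  case False
  with assms have x: "1 + x > 0" by simp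
  have "((1 + x) powr q) powr (1/q) * 1 powr (1 - 1/q) \<le> (1/q) * (1 + x) powr q + (1 - 1/q) * 1"
    using assms x by (intro Youngs_inequality_0) auto
  moreover have "((1 + x) powr q) powr (1/q) = 1 + x"
    using assms x by (simp add: powr_powr)
  ultimately have "1 + x \<le> (1/q) * (1 + x) powr q + (1 - 1/q)" by simp
  then have "q * (1 + x) \<le> q * ((1/q) * (1 + x) powr q + (1 - 1/q))"
    using assms by (intro mult_left_mono) auto
  also have "\<dots> = (1 + x) powr q + (q - 1)"
    using assms by (simp add: field_simps)
  finally show ?thesis by (simp add: algebra_simps)
qed (use assms in auto)

lemma powr_Bernoulli_le:
  fixes x q :: real
  assumes "0 \<le> q" "q \<le> 1" "-1 \<le> x"
  shows "(1 + x) powr q \<le> 1 + q * x"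
proof (cases "x = -1")
  case False
  then show ?thesis
    using Youngs_inequality_0[of q "1 - q" "1 + x" 1] assms by (simp add: algebra_simps)
qed (use assms in auto)

text \<open>Unlike \<^const>\<open>convex_on\<close> of the power function on the positive reals, this version includes
  the end point \<open>0\<close>.\<close>

lemma powr_convex_combination:
  fixes a b u v p :: real
  assumes "1 \<le> p" "0 \<le> a" "0 \<le> b" "0 \<le> u" "0 \<le> v" "u + v = 1"
  shows "(u * a + v * b) powr p \<le> u * a powr p + v * b powr p"
proof -
  have scale: "(w * c) powr p \<le> w * c powr p" if "0 \<le> w" "w \<le> 1" "0 \<le> c" for w c :: real
  proof -
    have "w powr p \<le> w"
      using that powr_le_one_le[of w p] assms(1) by (cases "w = 0") auto
    then show ?thesis
      using that by (simp add: powr_mult mult_right_mono)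
  qed
  consider "a = 0" | "b = 0" | "a > 0" "b > 0" using assms by linarith
  then show ?thesis
  proof cases
    case 3
    then show ?thesis
      using powr_convex[OF assms(1)] assms by (simp add: convex_on_def)
  qed (use scale[of u a] scale[of v b] assms in auto)
qed

text \<open>For \<open>0 \<le> z \<le> x + y\<close> the ratio \<open>z / (x + y)\<close> lies in \<open>[0, 1]\<close>, so its \<open>q\<close>-th power is at most
  the ratio itself, and the two ratios add up to \<open>1\<close>.\<close>

lemma powr_superadditive:
  fixes x y q :: real
  assumes "1 \<le> q" "0 \<le> x" "0 \<le> y"
  shows "x powr q + y powr q \<le> (x + y) powr q"
proof (cases "x + y = 0")
  case False
  with assms have s: "x + y > 0" by auto
  have *: "z powr q \<le> z / (x + y) * (x + y) powr q" if "0 \<le> z" "z \<le> x + y" for z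
  proof -
    have "(z / (x + y)) powr q \<le> z / (x + y)"
      using that s powr_le_one_le[of "z / (x + y)" q] assms(1) by (cases "z = 0") auto
    then have "(z / (x + y)) powr q * (x + y) powr q \<le> z / (x + y) * (x + y) powr q"
      by (intro mult_right_mono) auto
    then show ?thesis using that s by (simp add: powr_divide)
  qed
  have "x powr q + y powr q \<le> x / (x + y) * (x + y) powr q + y / (x + y) * (x + y) powr q"
    using *[of x] *[of y] assms by linarith
  also have "\<dots> = (x / (x + y) + y / (x + y)) * (x + y) powr q"
    by (simp add: algebra_simps)
  also have "x / (x + y) + y / (x + y) = 1"
    using s by (simp add: add_divide_distrib[symmetric])
  finally show ?thesis by simp
next
  case True
  with assms have "x = 0" "y = 0" by auto
  then show ?thesis by simp
qed

lemma powr_Suc_exponent: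
  fixes x q :: real
  assumes "0 \<le> x" shows "x powr (q + 1) = x * x powr q"
  using assms by (cases "x = 0") (auto simp: powr_add)

text \<open>The gap between \<open>t\<^sup>p\<close> and its tangent at \<open>1\<close> is at least \<open>\<bar>t - 1\<bar>\<^sup>p\<close> on the positive axis. With
  \<open>p = q + 1\<close> and \<open>s = \<bar>a - 1\<bar>\<close>, one factor \<open>1 \<plusminus> s\<close> of \<open>a\<^sup>p\<close> is split off and expanded; the summand
  without \<open>s\<close> is estimated by Bernoulli, the one with \<open>s\<close> by superadditivity.\<close>

lemma powr_tangent_gap_same_sign:
  fixes a p :: real
  assumes "2 \<le> p" "0 \<le> a"
  shows "\<bar>a - 1\<bar> powr p \<le> a powr p - 1 - p * (a - 1)"
proof -
  define q where "q = p - 1"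
  have q: "1 \<le> q" "p = q + 1" using assms by (auto simp: q_def)
  show ?thesis
  proof (cases "1 \<le> a")
    case True
    define s where "s = a - 1"
    have s: "0 \<le> s" "a = 1 + s" using True by (auto simp: s_def)
    have "1 + q * s \<le> (1 + s) powr q" using powr_Bernoulli_ge[of q s] q s by auto
    moreover have "s * (1 + s powr q) \<le> s * (1 + s) powr q"
      using powr_superadditive[of q 1 s] q s by (intro mult_left_mono) auto
    moreover have "a powr p = (1 + s) powr q + s * (1 + s) powr q"
      unfolding s(2) q(2) using s by (subst powr_Suc_exponent) (simp_all add: distrib_right)
    moreover have "\<bar>a - 1\<bar> powr p = s * s powr q"
      using s q by (simp add: powr_Suc_exponent)
    ultimately show ?thesis using s q by (simp add: algebra_simps)
  next
    case False
    define s where "s = 1 - a"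
    have s: "0 \<le> s" "s \<le> 1" "a = 1 - s" using False assms by (auto simp: s_def)
    have "1 - q * s \<le> (1 - s) powr q" using powr_Bernoulli_ge[of q "-s"] q s by auto
    moreover have "s * (1 - s) powr q \<le> s * (1 - s powr q)"
      using powr_superadditive[of q "1 - s" s] q s by (intro mult_left_mono) auto
    moreover have "a powr p = (1 - s) powr q - s * (1 - s) powr q"
      unfolding s(3) q(2) using s by (subst powr_Suc_exponent) (simp_all add: left_diff_distrib)
    moreover have "\<bar>a - 1\<bar> powr p = s * s powr q"
      using s q by (simp add: powr_Suc_exponent)
    ultimately have "s * s powr q \<le> (1 - s) powr q - s * (1 - s) powr q - 1 + p * s"
      unfolding q(2) by (simp add: algebra_simps)
    then show ?thesis
      unfolding \<open>a powr p = _\<close> \<open>\<bar>a - 1\<bar> powr p = _\<close> by (simp add: s(3))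
  qed
qed

text \<open>The same gap evaluated at \<open>-a\<close>, where it is \<open>a\<^sup>p + p a + q\<close>. For \<open>p = 2\<close> both sides coincide for
  all \<open>a\<close>, so every estimate in the proof is exact at \<open>q = 1\<close>: the convexity bound
  \<open>(1 + a)\<^sup>q \<le> 2\<^bsup>q-1\<^esup> (1 + a\<^sup>q)\<close>, the interpolation of \<open>a\<^sup>q\<close> between \<open>a\<close> and \<open>a\<^sup>p\<close>, and
  \<open>2\<^bsup>q-1\<^esup> \<le> q\<^sup>q\<close>.\<close>

lemma powr_tangent_gap_opposite_sign:
  fixes a p q :: real
  assumes "2 \<le> p" "0 \<le> a" "q = p - 1"
  shows "(1 + a) powr p \<le> q powr p * (a powr p + p * a + q)"
proof -
  have q: "1 \<le> q" "p = q + 1" using assms by auto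
  note assms = assms(2)
  have A: "(1 + a) powr q \<le> 2 powr (q - 1) * (1 + a powr q)"
  proof -
    have "(1/2 * 1 + 1/2 * a) powr q \<le> 1/2 * 1 powr q + 1/2 * a powr q"
      using q assms by (intro powr_convex_combination) auto
    moreover have "(1/2 * 1 + 1/2 * a) powr q = (1 + a) powr q / 2 powr q"
      using assms by (subst powr_divide[symmetric]) (auto simp: field_simps)
    ultimately have "(1 + a) powr q / 2 powr q \<le> 1/2 + 1/2 * a powr q"
      by simp
    then have "(1 + a) powr q \<le> 2 powr q * (1/2 + 1/2 * a powr q)"
      by (simp add: pos_divide_le_eq mult.commute)
    also have "\<dots> = 2 powr (q - 1) * (1 + a powr q)"
      by (simp add: powr_diff field_simps)
    finally show ?thesis .
  qed
  have B: "a powr q \<le> a / q + (1 - 1/q) * a powr p"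
  proof (cases "a = 0")
    case False
    then have a: "a > 0" using assms by auto
    have "a powr (1/q) * (a powr p) powr (1 - 1/q) \<le> 1/q * a + (1 - 1/q) * a powr p"
      using a q by (intro Youngs_inequality_0) auto
    moreover have "1/q + p * (1 - 1/q) = q" using q by (simp add: field_simps)
    ultimately show ?thesis
      using a by (simp add: powr_powr powr_add[symmetric])
  qed (use q in auto)
  have D: "2 - 1/q \<le> q"
  proof -
    have "0 \<le> (q - 1)\<^sup>2 / q" using q by auto
    then show ?thesis using q by (simp add: power2_eq_square field_simps)
  qed
  have C: "2 powr (q - 1) \<le> q powr q"
  proof -
    have "(1 + 1) powr ((q - 1) / q) \<le> 1 + (q - 1) / q * 1"
      using q by (intro powr_Bernoulli_le) auto
    also have "\<dots> = 2 - 1/q" using q by (simp add: field_simps)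
    also have "\<dots> \<le> q" by (rule D)
    finally have "(2 powr ((q - 1) / q)) powr q \<le> q powr q"
      using q by (intro powr_mono2) auto
    then show ?thesis using q by (simp add: powr_powr)
  qed
  have E: "0 \<le> a powr p" "0 \<le> q powr q" by auto
  have "(1 + a) powr p = (1 + a) * (1 + a) powr q"
    using q assms by (simp add: powr_Suc_exponent)
  also have "\<dots> \<le> (1 + a) * (2 powr (q - 1) * (1 + a powr q))"
    using A assms by (intro mult_left_mono) auto
  also have "\<dots> = 2 powr (q - 1) * (1 + a + a powr q + a powr p)"
  proof -
    have "a powr p = a * a powr q" using q assms by (simp add: powr_Suc_exponent)
    then show ?thesis by (simp add: algebra_simps)
  qed
  also have "\<dots> \<le> q powr q * (1 + a + a powr q + a powr p)"
    using C assms by (intro mult_right_mono) auto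
  also have "\<dots> \<le> q powr q * (q * (a powr p + p * a + q))"
  proof (intro mult_left_mono E)
    have "1 + a + a powr q + a powr p \<le> 1 + (1 + 1/q) * a + (2 - 1/q) * a powr p"
      using B by (simp add: algebra_simps)
    also have "\<dots> \<le> q * q + q * p * a + q * a powr p"
    proof (intro add_mono mult_right_mono D E assms)
      show "1 \<le> q * q" using q mult_mono[of 1 q 1 q] by simp
      have "1/q \<le> q" using q \<open>1 \<le> q * q\<close> by (simp add: field_simps)
      then show "1 + 1/q \<le> q * p" using q \<open>1 \<le> q * q\<close> by (simp add: algebra_simps)
    qed
    finally show "1 + a + a powr q + a powr p \<le> q * (a powr p + p * a + q)"
      by (simp add: algebra_simps)
  qed
  also have "\<dots> = q powr p * (a powr p + p * a + q)"
    using q by (simp add: powr_Suc_exponent)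
  finally show ?thesis .
qed

section \<open>The pointwise inequality\<close>

lemma cmod_sub_one_sq: "(cmod (x - 1))\<^sup>2 = (cmod x)\<^sup>2 + 1 - 2 * Re x"
  unfolding cmod_power2 by (simp add: power2_eq_square algebra_simps)

text \<open>This is the pointwise inequality for \<open>m = 1\<close>, \<open>x = 1 + y\<close> and \<open>c = q\<^sup>p\<close>. For fixed \<open>\<bar>x\<bar> = a\<close> the quantity
  \<open>\<bar>x - 1\<bar>\<^sup>p = (a\<^sup>2 + 1 - 2 Re x)\<^bsup>p/2\<^esup>\<close> is convex in \<open>Re x\<close> because \<open>p/2 \<ge> 1\<close>, and the other terms are affine
  in \<open>Re x\<close>. So only the extreme points \<open>x = a\<close> and \<open>x = -a\<close> matter, and there the claim is about the
  real tangent gaps. The weights \<open>u\<close> and \<open>v\<close> are those of \<open>Re x = u a + v (-a)\<close>.\<close>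

lemma normalized_bound_ge2:
  fixes p q :: real and x :: complex
  assumes "2 \<le> p" "q = p - 1"
  shows "q powr p * (1 + p * Re (x - 1)) \<le> q powr p * cmod x powr p - cmod (x - 1) powr p"
proof -
  define a where "a = cmod x"
  define s where "s = Re x"
  have a: "0 \<le> a" and s: "\<bar>s\<bar> \<le> a"
    using abs_Re_le_cmod by (auto simp: a_def s_def)
  obtain u v where uv: "0 \<le> u" "0 \<le> v" "u + v = 1" "s = u * a - v * a"
  proof (cases "a = 0")
    case True
    then show ?thesis using s by (intro that[of 1 0]) auto
  next
    case False
    then have "a > 0" using a by auto
    then show ?thesis
      using s by (intro that[of "(a + s) / (2 * a)" "(a - s) / (2 * a)"]) (auto simp: field_simps)
  qed
  have sq: "(cmod (x - 1))\<^sup>2 = u * (a - 1)\<^sup>2 + v * (a + 1)\<^sup>2"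
  proof -
    have "(cmod (x - 1))\<^sup>2 = a\<^sup>2 + 1 - 2 * s"
      by (simp add: cmod_sub_one_sq a_def s_def)
    also have "\<dots> = (u + v) * (a\<^sup>2 + 1) - 2 * (u * a - v * a)"
      using uv by simp
    also have "\<dots> = u * (a - 1)\<^sup>2 + v * (a + 1)\<^sup>2"
      by (simp add: power2_eq_square algebra_simps)
    finally show ?thesis .
  qed
  have half: "(z\<^sup>2) powr (p / 2) = \<bar>z\<bar> powr p" for z :: real
  proof -
    have "z\<^sup>2 = \<bar>z\<bar> powr 2" by simp
    then show ?thesis by (simp only: powr_powr) simp
  qed
  have "cmod (x - 1) powr p = (u * (a - 1)\<^sup>2 + v * (a + 1)\<^sup>2) powr (p / 2)"
    using half[of "cmod (x - 1)"] by (simp add: sq)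
  also have "\<dots> \<le> u * ((a - 1)\<^sup>2) powr (p / 2) + v * ((a + 1)\<^sup>2) powr (p / 2)"
    using assms uv by (intro powr_convex_combination) auto
  also have "\<dots> = u * \<bar>a - 1\<bar> powr p + v * (1 + a) powr p"
    using a by (simp add: half add.commute)
  also have "\<dots> \<le> u * (q powr p * (a powr p - 1 - p * (a - 1))) + v * (q powr p * (a powr p + p * a + q))"
  proof (intro add_mono mult_left_mono uv)
    have "1 \<le> q powr p" using assms by (intro ge_one_powr_ge_zero) auto
    moreover have "\<bar>a - 1\<bar> powr p \<le> a powr p - 1 - p * (a - 1)"
      by (rule powr_tangent_gap_same_sign) (use assms a in auto)
    ultimately show "\<bar>a - 1\<bar> powr p \<le> q powr p * (a powr p - 1 - p * (a - 1))"
      using mult_mono[of 1 "q powr p" "\<bar>a - 1\<bar> powr p" "a powr p - 1 - p * (a - 1)"] by simp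
    show "(1 + a) powr p \<le> q powr p * (a powr p + p * a + q)"
      by (rule powr_tangent_gap_opposite_sign) (use assms a in auto)
  qed
  also have "\<dots> = q powr p * ((u + v) * (a powr p + q) - p * (u * a - v * a))"
    by (simp add: assms(2) algebra_simps)
  also have "\<dots> = q powr p * (a powr p + q - p * s)"
    using uv by simp
  finally show ?thesis
    by (simp add: a_def s_def assms(2) algebra_simps)
qed

text \<open>Both sides agree at \<open>t = 0\<close> to first order. Bernoulli, applied to the exponents \<open>1 - q\<close> and \<open>q\<close>
  in \<open>[0, 1]\<close>, replaces the powers by rational functions of \<open>t\<close>; the difference of the latter
  factors as \<open>q\<^sup>2 (1 - q) t\<^sup>2 (1 - q t)\<close> over a positive denominator.\<close>

lemma powr_two_point:
  fixes t p q :: real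
  assumes "1 < p" "p \<le> 2" "q = p - 1" "-1 \<le> t" "q * t \<le> 1"
  shows "(1 - q * t) powr p + p\<^sup>2 * t \<le> (1 + t) powr p"
proof -
  have q: "0 < q" "q \<le> 1" "p = q + 1" using assms by auto
  note assms = assms(4,5)
  define d where "d = 1 + (1 - q) * t"
  have d: "0 < d"
  proof -
    have "(1 - q) * (-1) \<le> (1 - q) * t" using q assms by (intro mult_left_mono) auto
    then show ?thesis using q by (simp add: d_def)
  qed
  have lower: "(1 + t)\<^sup>2 / d \<le> (1 + t) powr p"
  proof (cases "t = -1")
    case False
    then have t: "1 + t > 0" using assms by auto
    have "(1 + t) powr (1 - q) \<le> d"
      unfolding d_def using q assms by (intro powr_Bernoulli_le) auto
    then have "(1 + t)\<^sup>2 / d \<le> (1 + t)\<^sup>2 / (1 + t) powr (1 - q)"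
      using t d by (intro divide_left_mono) auto
    also have "\<dots> = (1 + t) powr (2 - (1 - q))"
      using t by (subst powr_diff) simp
    also have "2 - (1 - q) = p" using q by simp
    finally show ?thesis .
  qed auto
  have upper: "(1 - q * t) powr p \<le> (1 - q * t) * (1 - q * (q * t))"
  proof -
    have "(1 + - (q * t)) powr q \<le> 1 + q * - (q * t)"
      using q assms by (intro powr_Bernoulli_le) auto
    then show ?thesis
      using q assms by (simp add: powr_Suc_exponent mult_left_mono)
  qed
  have "(1 + t)\<^sup>2 - d * ((1 - q * t) * (1 - q * (q * t)) + p\<^sup>2 * t) = q\<^sup>2 * (1 - q) * t\<^sup>2 * (1 - q * t)"
    unfolding d_def q(3) by (simp add: power2_eq_square algebra_simps)
  moreover have "0 \<le> q\<^sup>2 * (1 - q) * t\<^sup>2 * (1 - q * t)"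
    using q assms by (intro mult_nonneg_nonneg) auto
  ultimately have "(1 - q * t) * (1 - q * (q * t)) + p\<^sup>2 * t \<le> (1 + t)\<^sup>2 / d"
    using d by (simp add: field_simps)
  with lower upper show ?thesis by linarith
qed

text \<open>Burkholder's inequality
  \<open>b\<^sup>p - k\<^sup>p a\<^sup>p \<le> \<alpha> (b - k a) (a + b)\<^bsup>p-1\<^esup>\<close> with \<open>k = 1/q\<close> and \<open>\<alpha> = p\<^bsup>2-p\<^esup>\<close>. Equality holds at
  \<open>a = q b\<close>, where \<open>a\<close> and \<open>q b\<close> coincide with their weighted mean \<open>w = (q a + q b) / p\<close>; writing
  \<open>a = w (1 + t)\<close> and \<open>q b = w (1 - q t)\<close> reduces it to the previous lemma.\<close>

lemma Burkholder_two_point: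
  fixes a b p q :: real
  assumes "1 < p" "p \<le> 2" "q = p - 1" "0 \<le> a" "0 \<le> b" "0 < a + b"
  shows "p powr (2 - p) / q * ((a + b) powr q * (a - q * b)) \<le> (1 / q) powr p * a powr p - b powr p"
proof -
  have q: "0 < q" "q \<le> 1" "p = q + 1" using assms by auto
  have p: "0 < p" using assms by auto
  note two_point = powr_two_point[OF assms(1-3)]
  note assms = assms(4-6)
  define w where "w = q * (a + b) / p"
  have w: "w > 0" using assms q(1) p by (simp add: w_def)
  define t where "t = a / w - 1"
  have aw: "a = w * (1 + t)" using w by (simp add: t_def)
  have "p * w = q * a + q * b" using p by (simp add: w_def field_simps)
  then have "q * b = w * (1 - q * t)" unfolding q(3) using aw by (simp add: algebra_simps)
  have t: "-1 \<le> t" using assms w by (simp add: t_def)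
  have "0 \<le> w * (1 - q * t)" using \<open>q * b = _\<close> q assms by (metis mult_nonneg_nonneg less_imp_le)
  then have t2: "q * t \<le> 1" using w by (simp add: zero_le_mult_iff)
  have "w powr p * ((1 - q * t) powr p + p\<^sup>2 * t) \<le> w powr p * (1 + t) powr p"
    using two_point[OF t t2] by (intro mult_left_mono) auto
  also have "\<dots> = a powr p" using aw w t by (simp add: powr_mult)
  finally have "w powr p * (1 - q * t) powr p + p\<^sup>2 * t * w powr p \<le> a powr p"
    by (simp add: algebra_simps)
  then have 1: "(q * b) powr p + p\<^sup>2 * t * w powr p \<le> a powr p"
    unfolding \<open>q * b = _\<close> using w t2 by (simp add: powr_mult)
  have ab: "a - q * b = p * (w * t)"
    unfolding \<open>q * b = _\<close> q(3) by (subst aw) (simp add: algebra_simps)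
  have 2: "p\<^sup>2 * t * w powr p = p * w powr q * (a - q * b)"
    unfolding ab using w q by (simp add: powr_Suc_exponent power2_eq_square)
  have 3: "w powr q = q powr q * (a + b) powr q / p powr q"
    using assms q(1) p by (simp add: w_def powr_mult powr_divide)
  have "q powr p * b powr p + p * (q powr q * (a + b) powr q / p powr q) * (a - q * b) \<le> a powr p"
    using 1 q(1) assms unfolding 2 3 by (simp add: powr_mult)
  then have "(q powr p * b powr p + p * (q powr q * (a + b) powr q / p powr q) * (a - q * b)) / q powr p
      \<le> a powr p / q powr p"
    by (intro divide_right_mono) auto
  moreover have "(q powr p * b powr p + p * (q powr q * (a + b) powr q / p powr q) * (a - q * b)) / q powr p
     = b powr p + p powr (2 - p) / q * ((a + b) powr q * (a - q * b))"
  proof -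
    have "2 - p = 1 - q" using q by simp
    then have "p powr (2 - p) = p / p powr q" using p by (simp only: powr_diff) simp
    moreover have "q powr p = q * q powr q" using q by (simp add: powr_Suc_exponent)
    moreover have "q powr q \<noteq> 0" "p powr q \<noteq> 0" using q(1) p by auto
    ultimately show ?thesis using q(1) by (simp add: add_divide_distrib)
  qed
  ultimately show ?thesis using q by (simp add: powr_divide)
qed

text \<open>Here \<open>S = a + b\<close> and \<open>D = a - b\<close> for two sides \<open>a, b\<close> of a triangle whose third side has length \<open>1\<close>. The
  claim is affine in \<open>D\<close>, with the worst case \<open>D = 1\<close>; that case is an equality at \<open>S = 1\<close>, and the
  derivative in \<open>S\<close> has the right sign by the weighted mean inequality.\<close>

lemma triangle_slack_bound:
  fixes S D q :: real
  assumes "0 \<le> q" "q \<le> 1" "1 \<le> S" "D \<le> 1"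
  shows "(1 - q) + (1 + q) * (S * D) \<le> S powr q * ((1 - q) * S + (1 + q) * D)"
proof -
  define h where "h = (\<lambda>S. (1 - q) * S powr (1 + q) + (1 + q) * S powr q - (1 - q) - (1 + q) * S)"
  have "h 1 \<le> h S"
  proof (rule DERIV_nonneg_imp_nondecreasing[OF assms(3)])
    fix x :: real assume x: "1 \<le> x" "x \<le> S"
    have "(h has_real_derivative (1 + q) * ((1 - q) * x powr q + q * x powr (q - 1) - 1)) (at x)"
      unfolding h_def using x
      by (auto intro!: derivative_eq_intros simp: algebra_simps)
    moreover have "1 \<le> (1 - q) * x powr q + q * x powr (q - 1)"
      using Youngs_inequality_0[of "1 - q" q "x powr q" "x powr (q - 1)"] x assms
      by (simp add: powr_powr powr_add[symmetric] algebra_simps)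
    ultimately show "\<exists>y. (h has_real_derivative y) (at x) \<and> 0 \<le> y"
      using assms by (intro exI[of _ "(1 + q) * ((1 - q) * x powr q + q * x powr (q - 1) - 1)"] conjI) auto
  qed
  then have h: "0 \<le> h S" by (simp add: h_def)
  have Sq: "S powr q \<le> S" using powr_mono[of q 1 S] assms by simp
  have "(1 + q) * (S - S powr q) * D \<le> (1 + q) * (S - S powr q) * 1"
    using Sq assms by (intro mult_left_mono) auto
  moreover have "S powr (1 + q) = S * S powr q"
    using assms by (simp add: powr_add)
  ultimately show ?thesis using h by (simp add: h_def algebra_simps)
qed

text \<open>Again \<open>m = 1\<close> and \<open>x = 1 + y\<close>, now with \<open>c = p\<^bsup>2-p\<^esup> / q\<close>; this \<open>c\<close> is forced, because both sides vanish at
  \<open>x = q/p\<close> and must be tangent there. In terms of the moduli \<open>a = \<bar>x\<bar>\<close> and \<open>b = \<bar>x - 1\<bar>\<close> the left side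
  contains \<open>2 Re x = a\<^sup>2 - b\<^sup>2 + 1\<close>, and \<open>c (a + b)\<^sup>q (a - q b)\<close> from Burkholder's inequality lies between
  the two sides.\<close>

lemma normalized_bound_le2:
  fixes p q :: real and x :: complex
  assumes "1 < p" "p \<le> 2" "q = p - 1"
  shows "p powr (2 - p) / q * (1 + p * Re (x - 1))
    \<le> (1 / q) powr p * cmod x powr p - cmod (x - 1) powr p"
proof -
  have q: "0 < q" "q \<le> 1" "p = q + 1" using assms by auto
  note Burk = Burkholder_two_point[OF assms]
  define a b where "a = cmod x" and "b = cmod (x - 1)"
  have S: "1 \<le> a + b" using norm_triangle_ineq4[of x "x - 1"] by (simp add: a_def b_def)
  have D: "a - b \<le> 1" using norm_triangle_ineq2[of x "x - 1"] by (simp add: a_def b_def)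
  have Re: "2 * Re x = (a + b) * (a - b) + 1"
    using cmod_sub_one_sq[of x] by (simp add: a_def b_def power2_eq_square algebra_simps)
  have "2 * (1 + p * Re (x - 1)) = (1 - q) + (1 + q) * ((a + b) * (a - b))"
  proof -
    have "2 * (1 + p * Re (x - 1)) = 2 + p * (2 * Re x) - 2 * p" by (simp add: algebra_simps)
    then show ?thesis unfolding Re q(3) by (simp add: algebra_simps)
  qed
  also have "\<dots> \<le> (a + b) powr q * ((1 - q) * (a + b) + (1 + q) * (a - b))"
    using triangle_slack_bound[of q "a + b" "a - b"] q S D by simp
  also have "\<dots> = 2 * ((a + b) powr q * (a - q * b))" by (simp add: algebra_simps)
  finally have "1 + p * Re (x - 1) \<le> (a + b) powr q * (a - q * b)" by simp
  then have "p powr (2 - p) / q * (1 + p * Re (x - 1)) \<le> p powr (2 - p) / q * ((a + b) powr q * (a - q * b))"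
    using q by (intro mult_left_mono) auto
  also have "\<dots> \<le> (1 / q) powr p * a powr p - b powr p"
    using S by (intro Burk) (auto simp: a_def b_def)
  finally show ?thesis by (simp add: a_def b_def)
qed

lemma pstar_ge1:
  fixes p :: real assumes "1 < p"
  shows "1 \<le> max p (p / (p - 1)) - 1"
proof (cases "2 \<le> p")
  case False
  then have "2 \<le> p / (p - 1)" using assms by (simp add: field_simps)
  then show ?thesis by simp
qed auto

text \<open>Both sides are homogeneous of degree \<open>p\<close>, so division by \<open>m\<close> reduces the claim to \<open>m = 1\<close>. At
  \<open>m = 0\<close> the factor \<open>cmod m powr (p - 2)\<close> is \<open>0\<close> by convention, also for \<open>p < 2\<close>; this is the correct
  value of the product, as \<open>\<bar>m\<bar>\<^sup>p\<close> has derivative \<open>0\<close> at the origin.\<close>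

lemma pointwise_bound:
  fixes p k :: real
  assumes "1 < p" "k = max p (p / (p - 1)) - 1"
  obtains c where "\<And>m y :: complex. c * (cmod m powr p + p * (cmod m powr (p - 2) * Re (cnj m * y)))
                       \<le> k powr p * cmod (m + y) powr p - cmod y powr p"
proof -
  define q where "q = p - 1"
  obtain c where c: "\<And>x :: complex. c * (1 + p * Re (x - 1)) \<le> k powr p * cmod x powr p - cmod (x - 1) powr p"
  proof (cases "2 \<le> p")
    case True
    then have "p / (p - 1) \<le> p" using assms by (simp add: field_simps)
    then have "k = q" using assms by (simp add: q_def)
    then show ?thesis using normalized_bound_ge2[OF True q_def] by (intro that[of "q powr p"]) simp
  next
    case False
    then have "p \<le> p / (p - 1)" using assms by (simp add: field_simps)
    then have "k = 1 / q" using assms by (simp add: q_def field_simps)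
    then show ?thesis using normalized_bound_le2[OF assms(1) _ q_def] False by (intro that[of "p powr (2 - p) / q"]) simp
  qed
  have "c * (cmod m powr p + p * (cmod m powr (p - 2) * Re (cnj m * y)))
           \<le> k powr p * cmod (m + y) powr p - cmod y powr p" for m y :: complex
  proof (cases "m = 0")
    case True
    have "1 \<le> k powr p" using pstar_ge1[OF assms(1)] assms by (intro ge_one_powr_ge_zero) auto
    then show ?thesis using True assms mult_right_mono[of 1 "k powr p" "cmod y powr p"] by simp
  next
    case False
    define x where "x = 1 + y / m"
    have y: "y = m * (x - 1)" and my: "m + y = m * x" using False by (auto simp: x_def field_simps)
    have "cnj m * y = of_real ((cmod m)\<^sup>2) * (x - 1)"
      unfolding y by (simp add: complex_norm_square mult_ac del: of_real_power)
    then have Re: "Re (cnj m * y) = (cmod m)\<^sup>2 * Re (x - 1)" by (simp only: Re_complex_of_real Im_complex_of_real times_complex.simps)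
    have mp: "cmod m powr p = cmod m powr (p - 2) * (cmod m)\<^sup>2"
      using False powr_add[of "cmod m" "p - 2" 2] by simp
    have "cmod m powr p * (c * (1 + p * Re (x - 1))) \<le> cmod m powr p * (k powr p * cmod x powr p - cmod (x - 1) powr p)"
      using c by (intro mult_left_mono) auto
    moreover have "cmod m powr p * (k powr p * cmod x powr p - cmod (x - 1) powr p)
       = k powr p * cmod (m + y) powr p - cmod y powr p"
      unfolding my unfolding y unfolding norm_mult by (simp add: powr_mult right_diff_distrib)
    moreover have "cmod m powr p * (c * (1 + p * Re (x - 1)))
       = c * (cmod m powr p + p * (cmod m powr (p - 2) * Re (cnj m * y)))"
      unfolding Re by (subst (2) mp, subst mp) (simp add: algebra_simps)
    ultimately show ?thesis by (simp only:)
  qed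
  then show thesis by (rule that)
qed


section \<open>Calculus of smooth functions on the plane\<close>

lemma Ck_SucI:
  assumes "\<And>z. (f has_derivative f' z) (at z)" "\<And>v. Ck k (\<lambda>z. f' z v)"
  shows "Ck (Suc k) f"
proof -
  have "frechet_derivative f (at z) = f' z" for z
    using frechet_derivative_at[OF assms(1)] by simp
  then show ?thesis using assms by (auto simp: differentiable_def)
qed

lemma Ck_has_derivative:
  "Ck (Suc k) f \<Longrightarrow> (f has_derivative frechet_derivative f (at z)) (at z)"
  using frechet_derivative_works by auto

lemma Ck_SucD: "Ck (Suc k) f \<Longrightarrow> Ck k f"
proof (induction k arbitrary: f)
  case 0
  then have "f differentiable_on UNIV" by (auto simp: differentiable_on_def)
  then show ?case by (simp add: differentiable_imp_continuous_on)
next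
  case (Suc k)
  show ?case
    by (intro Ck_SucI[of f "\<lambda>z. frechet_derivative f (at z)"] Suc.IH Ck_has_derivative[OF Suc.prems])
       (use Suc.prems in simp)
qed

lemma Ck_continuous: "Ck k f \<Longrightarrow> continuous_on UNIV f"
  by (induction k) (use Ck_SucD in auto)

lemma Ck_const: "Ck k (\<lambda>_. c)"
proof (induction k arbitrary: c)
  case (Suc k)
  then show ?case by (intro Ck_SucI[of _ "\<lambda>_ _. 0"]) (auto intro!: derivative_eq_intros)
qed simp

lemma Ck_bounded_linear:
  assumes "bounded_linear L" shows "Ck k L"
proof (cases k)
  case (Suc k')
  then show ?thesis
    unfolding Suc using assms
    by (intro Ck_SucI[of L "\<lambda>_. L"] Ck_const bounded_linear_imp_has_derivative)
qed (use assms linear_continuous_on in auto)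

lemma Ck_add: "Ck k f \<Longrightarrow> Ck k g \<Longrightarrow> Ck k (\<lambda>z. f z + g z)"
proof (induction k arbitrary: f g)
  case (Suc k)
  show ?case
    by (rule Ck_SucI[OF has_derivative_add[OF Ck_has_derivative[OF Suc.prems(1)] Ck_has_derivative[OF Suc.prems(2)]]])
       (use Suc in auto)
qed (auto intro: continuous_intros)

lemma Ck_mult: "Ck k f \<Longrightarrow> Ck k g \<Longrightarrow> Ck k (\<lambda>z. f z * g z)"
proof (induction k arbitrary: f g)
  case (Suc k)
  show ?case
  proof (rule Ck_SucI[OF has_derivative_mult[OF Ck_has_derivative[OF Suc.prems(1)] Ck_has_derivative[OF Suc.prems(2)]]])
    show "Ck k (\<lambda>z. f z * frechet_derivative g (at z) v + frechet_derivative f (at z) v * g z)" for v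
      using Suc by (intro Ck_add Suc.IH Ck_SucD[OF Suc.prems(1)] Ck_SucD[OF Suc.prems(2)]) auto
  qed
qed (auto intro: continuous_intros)

lemma has_derivative_dilation:
  fixes f :: "complex \<Rightarrow> complex"
  assumes "(f has_derivative f') (at (c *\<^sub>R z))"
  shows "((\<lambda>z. f (c *\<^sub>R z)) has_derivative (\<lambda>v. f' (c *\<^sub>R v))) (at z)"
  using has_derivative_compose[of "\<lambda>z. c *\<^sub>R z" "\<lambda>v. c *\<^sub>R v" z UNIV f f'] assms
  by (simp add: bounded_linear_imp_has_derivative bounded_linear_scaleR_right)

lemma Ck_dilation: "Ck k f \<Longrightarrow> Ck k (\<lambda>z. f (c *\<^sub>R z))"
proof (induction k arbitrary: f)
  case 0
  then show ?case by (auto intro!: continuous_intros continuous_on_compose2[of UNIV f])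
next
  case (Suc k)
  show ?case
    by (rule Ck_SucI[OF has_derivative_dilation[OF Ck_has_derivative[OF Suc.prems]]])
       (use Suc in auto)
qed

lemma frechet_derivative_partials:
  assumes "f differentiable (at w)"
  shows "frechet_derivative f (at w) v = of_real (Re v) * partial_x f w + of_real (Im v) * partial_y f w"
proof -
  interpret bounded_linear "frechet_derivative f (at w)"
    using assms by (metis frechet_derivative_works has_derivative_bounded_linear)
  have "v = Re v *\<^sub>R 1 + Im v *\<^sub>R \<i>" by (simp add: complex_eq_iff)
  then have "frechet_derivative f (at w) v = frechet_derivative f (at w) (Re v *\<^sub>R 1 + Im v *\<^sub>R \<i>)"
    by simp
  then show ?thesis
    unfolding add scaleR by (simp add: partial_x_def partial_y_def scaleR_conv_of_real)
qed

lemma continuous_on_frechet_derivative: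
  assumes "Ck (Suc k) f" "continuous_on S g" "continuous_on S h"
  shows "continuous_on S (\<lambda>x. frechet_derivative f (at (g x)) (h x))"
proof -
  have D: "f differentiable (at z)" for z using assms(1) by auto
  have 1: "continuous_on UNIV (partial_x f)" "continuous_on UNIV (partial_y f)"
    using assms(1) Ck_continuous by (auto simp: partial_x_def[abs_def] partial_y_def[abs_def])
  show ?thesis
    unfolding frechet_derivative_partials[OF D]
    by (intro continuous_intros assms continuous_on_compose2[OF 1(1)] continuous_on_compose2[OF 1(2)]) auto
qed

lemma frechet_derivative_real_scaling:
  assumes "Ck (Suc k) f"
  shows "frechet_derivative f (at w) (of_real c * v) = of_real c * frechet_derivative f (at w) v"
  using has_derivative_bounded_linear[OF Ck_has_derivative[OF assms, of w]]
  by (metis bounded_linear.linear linear_cmul scaleR_conv_of_real)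

section \<open>Ray means and the Euler operator\<close>

text \<open>The exponent \<open>m = 1\<close> gives the solution of \<open>2M + E M = f\<close>. Differentiating the ray mean raises the
  exponent by one, so the induction for smoothness needs all exponents. Integrating along rays
  from the origin, instead of dividing a radial integral by \<open>\<bar>z\<bar>\<^sup>2\<close>, makes smoothness at \<open>0\<close>
  evident.\<close>

definition ray_mean :: "nat \<Rightarrow> (complex \<Rightarrow> complex) \<Rightarrow> complex \<Rightarrow> complex" where
  "ray_mean m f z = integral {0..1} (\<lambda>s. of_real (s ^ m) * f (s *\<^sub>R z))"

lemma ray_mean_has_derivative:
  assumes "Ck (Suc k) f"
  shows "(ray_mean m f has_derivative (\<lambda>v. ray_mean (Suc m) (\<lambda>w. frechet_derivative f (at w) v) z)) (at z)"
proof -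
  let ?D = "\<lambda>z s v. of_real (s ^ Suc m) * frechet_derivative f (at (s *\<^sub>R z)) v"
  have lin: "bounded_linear (frechet_derivative f (at w))" for w
    using Ck_has_derivative[OF assms] has_derivative_bounded_linear by blast
  have bl: "bounded_linear (?D z s)" for z s
    by (intro bounded_linear_const_mult lin)
  have app: "blinfun_apply (Blinfun (?D z s)) = ?D z s" for z s
    using bl by (rule bounded_linear_Blinfun_apply)
  have der: "((\<lambda>z. of_real (s ^ m) * f (s *\<^sub>R z)) has_derivative ?D z s) (at z)" for z s
  proof -
    have "((\<lambda>z. of_real (s ^ m) * f (s *\<^sub>R z)) has_derivative
        (\<lambda>v. of_real (s ^ m) * frechet_derivative f (at (s *\<^sub>R z)) (s *\<^sub>R v))) (at z)"
      by (intro has_derivative_mult_right has_derivative_dilation Ck_has_derivative[OF assms])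
    also have "(\<lambda>v. of_real (s ^ m) * frechet_derivative f (at (s *\<^sub>R z)) (s *\<^sub>R v)) = ?D z s"
      by (auto simp: frechet_derivative_real_scaling[OF assms] scaleR_conv_of_real)
    finally show ?thesis .
  qed
  have cont: "continuous_on UNIV f" using Ck_continuous[OF assms] .
  have contD: "continuous_on (UNIV \<times> cbox 0 1) (\<lambda>(z, s). Blinfun (?D z s))"
    unfolding split_beta
    by (intro continuous_on_blinfun_componentwise, unfold app)
       (intro continuous_intros continuous_on_frechet_derivative[OF assms])
  have "((\<lambda>z. integral (cbox 0 1) (\<lambda>s. of_real (s ^ m) * f (s *\<^sub>R z))) has_derivative
      integral (cbox 0 1) (\<lambda>s. Blinfun (?D z s))) (at z within UNIV)"
  proof (rule leibniz_rule[OF _ _ contD])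
    show "(\<lambda>s. of_real (s ^ m) * f (s *\<^sub>R z)) integrable_on cbox 0 1" for z
      by (intro integrable_continuous continuous_intros continuous_on_compose2[OF cont]) auto
  qed (simp_all only: app der UNIV_I convex_UNIV)
  moreover have "blinfun_apply (integral (cbox 0 1) (\<lambda>s. Blinfun (?D z s)))
     = (\<lambda>v. ray_mean (Suc m) (\<lambda>w. frechet_derivative f (at w) v) z)"
  proof
    have "continuous_on (cbox 0 1) (\<lambda>s. case (z, s) of (z, s) \<Rightarrow> Blinfun (?D z s))"
      by (rule continuous_on_compose2[OF contD]) (auto intro!: continuous_intros)
    then have "continuous_on (cbox 0 1) (\<lambda>s. Blinfun (?D z s))"
      by (simp only: split_conv)
    then have "(\<lambda>s. Blinfun (?D z s)) integrable_on cbox 0 1"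
      by (rule integrable_continuous)
    then show "blinfun_apply (integral (cbox 0 1) (\<lambda>s. Blinfun (?D z s))) v
      = ray_mean (Suc m) (\<lambda>w. frechet_derivative f (at w) v) z" for v
      by (simp only: blinfun_apply_integral app ray_mean_def cbox_interval)
  qed
  ultimately show ?thesis
    by (simp add: ray_mean_def[abs_def])
qed

lemma Ck_ray_mean: "Ck k f \<Longrightarrow> Ck k (ray_mean m f)"
proof (induction k arbitrary: f m)
  case 0
  then have cont: "continuous_on UNIV f" by simp
  have "continuous_on UNIV (\<lambda>z. integral (cbox 0 1) (\<lambda>s. of_real (s ^ m) * f (s *\<^sub>R z)))"
    by (rule integral_continuous_on_param)
       (auto simp: split_beta intro!: continuous_intros continuous_on_compose2[OF cont])
  then show ?case by (simp add: ray_mean_def[abs_def])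
next
  case (Suc k)
  show ?case
    by (rule Ck_SucI[OF ray_mean_has_derivative[OF Suc.prems]]) (use Suc in auto)
qed

definition euler_op :: "(complex \<Rightarrow> complex) \<Rightarrow> complex \<Rightarrow> complex" where
  "euler_op f z = frechet_derivative f (at z) z"

lemma dilation_has_vector_derivative:
  assumes "Ck (Suc k) f"
  shows "((\<lambda>s. f (s *\<^sub>R z)) has_vector_derivative frechet_derivative f (at (s *\<^sub>R z)) z) (at s within S)"
proof -
  have "((\<lambda>s. s *\<^sub>R z) has_derivative (\<lambda>h. h *\<^sub>R z)) (at s within S)"
    by (auto intro!: derivative_eq_intros)
  from has_derivative_compose[OF this Ck_has_derivative[OF assms]]
  show ?thesis
    by (simp add: has_vector_derivative_def scaleR_conv_of_real frechet_derivative_real_scaling[OF assms])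
qed

lemma dilation_sq_has_vector_derivative:
  assumes "Ck (Suc k) f"
  shows "((\<lambda>s. of_real (s\<^sup>2) * f (s *\<^sub>R z)) has_vector_derivative
          of_real s * (2 * f (s *\<^sub>R z) + euler_op f (s *\<^sub>R z))) (at s within S)"
proof -
  have e: "euler_op f (s *\<^sub>R z) = of_real s * frechet_derivative f (at (s *\<^sub>R z)) z"
    by (simp add: euler_op_def scaleR_conv_of_real frechet_derivative_real_scaling[OF assms])
  have "((\<lambda>s. complex_of_real (s\<^sup>2)) has_vector_derivative of_real (2 * s)) (at s within S)"
    by (rule has_vector_derivative_of_real) (auto intro!: derivative_eq_intros)
  from has_vector_derivative_mult[OF this dilation_has_vector_derivative[OF assms]]
  show ?thesis
    by (rule has_vector_derivative_eq_rhs) (simp add: e algebra_simps power2_eq_square)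
qed

text \<open>The integrand \<open>2 s f(sz) + s\<^sup>2 Df(sz)[z]\<close> of the left side is the derivative of \<open>s\<^sup>2 f(sz)\<close> with
  respect to \<open>s\<close>.\<close>

lemma ray_mean_solves_euler:
  assumes "Ck (Suc k) f"
  shows "2 * ray_mean 1 f z + euler_op (ray_mean 1 f) z = f z"
proof -
  have cont: "continuous_on UNIV f" using Ck_continuous[OF assms] .
  have "((\<lambda>s. of_real s * (2 * f (s *\<^sub>R z) + euler_op f (s *\<^sub>R z)))
      has_integral of_real (1\<^sup>2) * f (1 *\<^sub>R z) - of_real (0\<^sup>2) * f (0 *\<^sub>R z)) {0..1}"
    by (intro fundamental_theorem_of_calculus dilation_sq_has_vector_derivative[OF assms]) auto
  then have "f z = integral {0..1} (\<lambda>s. of_real s * (2 * f (s *\<^sub>R z) + euler_op f (s *\<^sub>R z)))"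
    by (simp add: integral_unique)
  also have "\<dots> = integral {0..1} (\<lambda>s. 2 * (of_real (s ^ 1) * f (s *\<^sub>R z)) +
       of_real (s ^ Suc 1) * frechet_derivative f (at (s *\<^sub>R z)) z)"
    by (intro arg_cong2[where f=integral] refl ext)
       (simp add: euler_op_def frechet_derivative_real_scaling[OF assms] scaleR_conv_of_real distrib_left)
  also have "\<dots> = 2 * ray_mean 1 f z + ray_mean (Suc 1) (\<lambda>w. frechet_derivative f (at w) z) z"
    unfolding ray_mean_def
    by (subst integral_add)
       (auto intro!: integrable_continuous_interval continuous_intros continuous_on_compose2[OF cont]
          continuous_on_frechet_derivative[OF assms])
  also have "ray_mean (Suc 1) (\<lambda>w. frechet_derivative f (at w) z) z = euler_op (ray_mean 1 f) z"
    unfolding euler_op_def using frechet_derivative_at[OF ray_mean_has_derivative[OF assms], of 1 z]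
    by (metis)
  finally show ?thesis by simp
qed

text \<open>With \<open>M\<close> the ray mean, the derivative of \<open>s\<^sup>2 M(sz)\<close> in \<open>s\<close> is \<open>s (2M + E M)(sz) = s f(sz)\<close>, which vanishes as long as
  \<open>sz\<close> stays outside the support. Hence \<open>M(z)\<close> is homogeneous of degree \<open>-2\<close> there.\<close>

lemma ray_mean_outside_support:
  assumes "Ck (Suc k) f" "\<And>w. R \<le> cmod w \<Longrightarrow> f w = 0" "0 < l" "l \<le> 1" "R \<le> l * cmod z"
  shows "of_real (l\<^sup>2) * ray_mean 1 f (l *\<^sub>R z) = ray_mean 1 f z"
proof -
  let ?g = "\<lambda>s. of_real (s\<^sup>2) * ray_mean 1 f (s *\<^sub>R z)"
  have "(?g has_derivative (\<lambda>h. 0)) (at s within {l..1})" if "s \<in> {l..1}" for s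
  proof -
    have "R \<le> cmod (s *\<^sub>R z)"
      using that assms(3,5) mult_right_mono[of l s "cmod z"] by simp
    then have "f (s *\<^sub>R z) = 0" by (rule assms(2))
    then show ?thesis
      using dilation_sq_has_vector_derivative[OF Ck_ray_mean[OF assms(1)], of 1 z s "{l..1}"]
      by (simp add: ray_mean_solves_euler[OF assms(1), simplified] has_vector_derivative_def)
  qed
  then obtain c where "\<And>s. s \<in> {l..1} \<Longrightarrow> ?g s = c"
    using has_derivative_zero_constant[of "{l..1}" ?g] by auto
  from this[of l] this[of 1] assms show ?thesis by simp
qed

lemma radial_ray_mean:
  assumes "radial f" shows "radial (ray_mean m f)"
proof -
  have f: "f z = f (of_real (cmod z))" for z using assms unfolding radial_def by blast
  have "ray_mean m f z = ray_mean m f (of_real (cmod z))" for z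
    unfolding ray_mean_def
  proof (intro integral_cong)
    fix s :: real assume "s \<in> {0..1}"
    then have "f (s *\<^sub>R z) = f (s *\<^sub>R of_real (cmod z))"
      by (subst (1 2) f) simp
    then show "of_real (s ^ m) * f (s *\<^sub>R z) = of_real (s ^ m) * f (s *\<^sub>R of_real (cmod z))" by simp
  qed
  then show ?thesis by (simp add: radial_def)
qed

text \<open>The vector \<open>\<i> z\<close> is tangent at \<open>z\<close> to the circle around \<open>0\<close>, on which a radial function is constant.\<close>

lemma radial_angular_derivative:
  assumes "radial f" "(f has_derivative f') (at z)"
  shows "f' (\<i> * z) = 0"
proof -
  let ?c = "\<lambda>t::real. z * exp (\<i> * of_real t)"
  have "(?c has_vector_derivative z * \<i>) (at 0)"
  proof -
    have "((\<lambda>w. z * exp (\<i> * w)) has_field_derivative z * \<i>) (at (of_real 0))"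
      by (auto intro!: derivative_eq_intros)
    then show ?thesis by (rule has_vector_derivative_real_field)
  qed
  moreover have "(f has_derivative f') (at (?c 0))" using assms by simp
  ultimately have "((f \<circ> ?c) has_vector_derivative f' (z * \<i>)) (at 0)"
    using has_derivative_compose[of ?c "\<lambda>h. h *\<^sub>R (z * \<i>)" 0 UNIV f f']
      has_derivative_bounded_linear[OF assms(2)]
    by (simp add: has_vector_derivative_def linear_simps o_def)
  moreover have "f \<circ> ?c = (\<lambda>_. f z)"
  proof
    fix t
    have f: "f z = f (of_real (cmod z))" for z using assms(1) unfolding radial_def by blast
    have "cmod (?c t) = cmod z" by (simp add: norm_mult)
    then show "(f \<circ> ?c) t = f z" using f[of "?c t"] f[of z] by simp
  qed
  ultimately have "((\<lambda>_::real. f z) has_vector_derivative f' (z * \<i>)) (at 0)" by simp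
  then show ?thesis
    using vector_derivative_unique_at[OF _ has_vector_derivative_const] by (metis mult.commute)
qed

text \<open>With \<open>\<alpha>, \<beta>\<close> the partial derivatives of \<open>N\<close> and \<open>z = x + \<i> y\<close>, the vanishing angular
  derivative says \<open>y \<alpha> = x \<beta>\<close>. Therefore \<open>cnj z * dbar N\<close> and \<open>z * d N\<close> both equal \<open>x \<alpha> + y \<beta> = E N\<close>, and
  \<open>d (cnj z * N) = cnj z * d N\<close> has the modulus of \<open>z * d N\<close>. The summand \<open>2 N\<close> comes from
  \<open>dbar (cnj z) = 2\<close>.\<close>

lemma ops_of_conj_times_radial:
  assumes "radial N" "N differentiable (at z)"
  shows "dbar_op (\<lambda>z. cnj z * N z) z = 2 * N z + euler_op N z"
    and "cmod (d_op (\<lambda>z. cnj z * N z) z) = cmod (euler_op N z)"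
proof -
  let ?D = "frechet_derivative N (at z)" and ?\<alpha> = "partial_x N z" and ?\<beta> = "partial_y N z"
  have N: "(N has_derivative ?D) (at z)" using assms(2) frechet_derivative_works by blast
  have "((\<lambda>z. cnj z * N z) has_derivative (\<lambda>v. cnj z * ?D v + cnj v * N z)) (at z)"
    by (intro has_derivative_mult N bounded_linear_imp_has_derivative bounded_linear_cnj)
  from frechet_derivative_at[OF this]
  have F: "frechet_derivative (\<lambda>z. cnj z * N z) (at z) = (\<lambda>v. cnj z * ?D v + cnj v * N z)" by simp
  have E: "euler_op N z = of_real (Re z) * ?\<alpha> + of_real (Im z) * ?\<beta>"
    by (simp add: euler_op_def frechet_derivative_partials[OF assms(2)])
  have A: "of_real (Im z) * ?\<alpha> = of_real (Re z) * ?\<beta>"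
    using radial_angular_derivative[OF assms(1) N] by (simp add: frechet_derivative_partials[OF assms(2)])
  have x: "partial_x (\<lambda>z. cnj z * N z) z = cnj z * ?\<alpha> + N z"
    and y: "partial_y (\<lambda>z. cnj z * N z) z = cnj z * ?\<beta> - \<i> * N z"
    by (simp_all add: partial_x_def partial_y_def F)
  have z: "z = of_real (Re z) + \<i> * of_real (Im z)" "cnj z = of_real (Re z) - \<i> * of_real (Im z)"
    by (simp_all add: complex_eq_iff)
  have "dbar_op (\<lambda>z. cnj z * N z) z = 2 * N z + cnj z * (?\<alpha> + \<i> * ?\<beta>)"
    by (simp add: dbar_op_def x y algebra_simps)
  also have "cnj z * (?\<alpha> + \<i> * ?\<beta>) = euler_op N z + \<i> * (of_real (Re z) * ?\<beta> - of_real (Im z) * ?\<alpha>)"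
    unfolding E z(2) by (simp add: algebra_simps)
  finally show "dbar_op (\<lambda>z. cnj z * N z) z = 2 * N z + euler_op N z" by (simp add: A)
  have "d_op (\<lambda>z. cnj z * N z) z = cnj z * (?\<alpha> - \<i> * ?\<beta>)"
    by (simp add: d_op_def x y algebra_simps)
  then have "cmod (d_op (\<lambda>z. cnj z * N z) z) = cmod (z * (?\<alpha> - \<i> * ?\<beta>))"
    by (simp add: norm_mult)
  also have "z * (?\<alpha> - \<i> * ?\<beta>) = euler_op N z + \<i> * (of_real (Im z) * ?\<alpha> - of_real (Re z) * ?\<beta>)"
    unfolding E by (subst z(1)) (simp add: algebra_simps)
  finally show "cmod (d_op (\<lambda>z. cnj z * N z) z) = cmod (euler_op N z)" by (simp add: A)
qed


section \<open>The integral inequality for the Euler operator\<close>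

text \<open>At \<open>w = 0\<close> the formula gives the zero map, which is the derivative since \<open>p > 1\<close>.\<close>

lemma cmod_powr_has_derivative:
  assumes "1 < p"
  shows "((\<lambda>w. cmod w powr p) has_derivative (\<lambda>h. p * (cmod w powr (p - 2) * Re (cnj w * h)))) (at w)"
proof (cases "w = 0")
  case True
  have "((\<lambda>h. cmod h powr (p - 1)) \<longlongrightarrow> 0) (at 0)"
    using assms by (auto intro!: tendsto_eq_intros tendsto_zero_powrI)
  then have "((\<lambda>h. norm (cmod h powr p) / cmod h) \<longlongrightarrow> 0) (at 0)"
    by (rule Lim_transform_eventually) (auto simp: eventually_at_filter powr_diff)
  then show ?thesis using True by (simp add: has_derivative_at)
next
  case False
  have "((\<lambda>x. x powr p) has_real_derivative p * cmod w powr (p - 1)) (at (cmod w))"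
    using False by (auto intro!: derivative_eq_intros)
  then have "((\<lambda>w. cmod w powr p) has_derivative (\<lambda>h. p * cmod w powr (p - 1) * (sgn w \<bullet> h))) (at w)"
    using has_derivative_compose[OF has_derivative_norm[OF False]]
    by (simp add: has_field_derivative_def inner_commute)
  moreover have "p * cmod w powr (p - 1) * (sgn w \<bullet> h) = p * (cmod w powr (p - 2) * Re (cnj w * h))" for h
  proof -
    have "cmod w powr (p - 1) = cmod w powr (p - 2) * cmod w"
      using False powr_add[of "cmod w" "p - 2" 1] by simp
    moreover have "cmod w * (sgn w \<bullet> h) = Re (cnj w * h)"
      using False by (simp add: sgn_div_norm inner_complex_def field_simps)
    ultimately show ?thesis by (metis mult.assoc)
  qed
  ultimately show ?thesis by simp
qed

lemma continuous_on_cmod_powr_weight: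
  fixes p :: real
  assumes "1 < p"
  shows "continuous_on UNIV (\<lambda>w. of_real (cmod w powr (p - 2)) * cnj w)"
proof -
  have "isCont (\<lambda>w. of_real (cmod w powr (p - 2)) * cnj w) w" for w
  proof (cases "w = 0")
    case False
    then show ?thesis by (auto intro!: continuous_intros)
  next
    case True
    have "((\<lambda>h. cmod h powr (p - 1)) \<longlongrightarrow> 0) (at 0)"
      using assms by (auto intro!: tendsto_eq_intros tendsto_zero_powrI)
    then have "((\<lambda>h. norm (of_real (cmod h powr (p - 2)) * cnj h)) \<longlongrightarrow> 0) (at 0)"
    proof (rule Lim_transform_eventually)
      have "cmod h powr (p - 1) = norm (of_real (cmod h powr (p - 2)) * cnj h)" if "h \<noteq> 0" for h
        using that powr_add[of "cmod h" "p - 2" 1] by (simp add: norm_mult)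
      then show "\<forall>\<^sub>F h in at 0. cmod h powr (p - 1) = norm (of_real (cmod h powr (p - 2)) * cnj h)"
        by (auto simp: eventually_at_filter)
    qed
    then show ?thesis
      unfolding True isCont_def by (simp add: tendsto_norm_zero_iff)
  qed
  then show ?thesis by (simp add: continuous_on_eq_continuous_at)
qed

lemma continuous_on_cmod_powr:
  fixes p :: real
  assumes "1 < p" "continuous_on S g"
  shows "continuous_on S (\<lambda>x. cmod (g x) powr p)"
proof -
  have "continuous_on UNIV (\<lambda>w. cmod w powr p)"
    using has_derivative_continuous[OF cmod_powr_has_derivative[OF assms(1)]]
    by (simp add: continuous_on_eq_continuous_at)
  then show ?thesis using assms(2) by (rule continuous_on_compose2) auto
qed

lemma compact_support_integrable:
  fixes g :: "complex \<Rightarrow> real"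
  assumes "continuous_on UNIV g" "\<And>z. R \<le> cmod z \<Longrightarrow> g z = 0"
  shows "integrable lborel g"
proof -
  have "integrable lborel (\<lambda>x. indicator (cball 0 R) x *\<^sub>R g x)"
    using assms(1) by (intro borel_integrable_compact) (auto intro: continuous_on_subset)
  also have "(\<lambda>x. indicator (cball 0 R) x *\<^sub>R g x) = g"
  proof
    show "indicator (cball 0 R) x *\<^sub>R g x = g x" for x
      using assms(2)[of x] by (cases "cmod x \<le> R") (auto simp: indicator_def)
  qed
  finally show ?thesis .
qed

lemma compact_support_integral_cbox:
  fixes g :: "complex \<Rightarrow> real"
  assumes "continuous_on UNIV g" "\<And>z. R \<le> cmod z \<Longrightarrow> g z = 0" "cball 0 R \<subseteq> cbox a b"
  shows "integral (cbox a b) g = (LINT z|lborel. g z)"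
proof -
  have "(g has_integral (LINT z|lborel. g z)) UNIV"
    using has_integral_integral_lborel[OF compact_support_integrable[OF assms(1,2)]] by simp
  moreover have "g z = 0" if "z \<notin> cbox a b" for z
  proof -
    have "z \<notin> cball 0 R" using that assms(3) by blast
    then show ?thesis by (intro assms(2)) auto
  qed
  ultimately have "(g has_integral (LINT z|lborel. g z)) (cbox a b)"
    using has_integral_on_superset[of g] has_integral_restrict_UNIV[of "cbox a b" g]
    by (smt (verit, best) has_integral_eq)
  then show ?thesis by (rule integral_unique)
qed

lemma integral_dilation:
  fixes g :: "complex \<Rightarrow> real"
  assumes "0 < c" "g \<in> borel_measurable borel"
  shows "(LINT z|lborel. c\<^sup>2 * g (c *\<^sub>R z)) = (LINT z|lborel. g z)"
proof -
  have "(lborel :: complex measure) = density (distr lborel borel (\<lambda>x. 0 + c *\<^sub>R x)) (\<lambda>_. ennreal (\<bar>c\<bar> ^ DIM(complex)))"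
    using assms by (intro lborel_affine) auto
  then have "(LINT z|lborel. g z) = (LINT z|density (distr lborel borel (\<lambda>x. 0 + c *\<^sub>R x)) (\<lambda>_. ennreal (\<bar>c\<bar> ^ DIM(complex))). g z)"
    by (rule arg_cong)
  also have "\<dots> = (LINT z|lborel. c\<^sup>2 * g (c *\<^sub>R z))"
    using assms by (subst integral_density) (auto simp: integral_distr)
  finally show ?thesis by simp
qed

text \<open>The integrand is \<open>2W + E W\<close> for \<open>W = \<bar>N\<bar>\<^sup>p\<close>, which is the derivative of \<open>r\<^sup>2 W(rz)\<close> at \<open>r = 1\<close>. The
  integral of \<open>r\<^sup>2 W(rz)\<close> over the plane does not depend on \<open>r\<close>, because \<open>r\<^sup>2\<close> is the Jacobian of the
  dilation.\<close>

lemma integral_radial_divergence: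
  fixes p :: real
  assumes "1 < p" "Ck (Suc k) N" "\<And>z. R \<le> cmod z \<Longrightarrow> N z = 0"
  shows "(LINT z|lborel. 2 * cmod (N z) powr p + p * (cmod (N z) powr (p - 2) * Re (cnj (N z) * euler_op N z))) = 0"
proof -
  define dW where "dW = (\<lambda>(r::real) z. p * (cmod (N (r *\<^sub>R z)) powr (p - 2) *
       Re (cnj (N (r *\<^sub>R z)) * frechet_derivative N (at (r *\<^sub>R z)) z)))"
  define F where "F = (\<lambda>(r::real) z. r\<^sup>2 * cmod (N (r *\<^sub>R z)) powr p)"
  define F' where "F' = (\<lambda>(r::real) z. 2 * r * cmod (N (r *\<^sub>R z)) powr p + r\<^sup>2 * dW r z)"
  define U where "U = {1/2<..<2::real}"
  have contN: "continuous_on UNIV N" using Ck_continuous[OF assms(2)] .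
  have dW_alt: "dW r z = p * Re (of_real (cmod (N (r *\<^sub>R z)) powr (p - 2)) * cnj (N (r *\<^sub>R z)) * frechet_derivative N (at (r *\<^sub>R z)) z)" for r z
    by (simp add: dW_def mult.assoc)
  have derF: "((\<lambda>r. F r z) has_real_derivative F' r z) (at r within S)" for r z S
  proof -
    have "((\<lambda>r. N (r *\<^sub>R z)) has_derivative (\<lambda>h. h *\<^sub>R frechet_derivative N (at (r *\<^sub>R z)) z)) (at r within S)"
      using dilation_has_vector_derivative[OF assms(2)] by (simp add: has_vector_derivative_def)
    from has_derivative_compose[OF this cmod_powr_has_derivative[OF assms(1)]]
    have dW: "((\<lambda>r. cmod (N (r *\<^sub>R z)) powr p) has_real_derivative dW r z) (at r within S)"
      unfolding has_field_derivative_def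
      by (rule has_derivative_eq_rhs) (auto simp: dW_def algebra_simps)
    have sq: "((\<lambda>r. r\<^sup>2) has_real_derivative 2 * r) (at r within S)"
      by (auto intro!: derivative_eq_intros)
    show ?thesis unfolding F_def F'_def
      by (rule DERIV_mult[OF sq dW, THEN DERIV_cong]) (simp add: mult_ac)
  qed
  have contF': "continuous_on S (\<lambda>x. F' (f x) (g x))"
    if "continuous_on S f" "continuous_on S g" for f g and S :: "'a::topological_space set"
    unfolding F'_def dW_alt using that assms(1)
    by (intro continuous_intros continuous_on_cmod_powr continuous_on_compose2[OF contN]
         continuous_on_compose2[OF continuous_on_cmod_powr_weight[OF assms(1)]]
         continuous_on_frechet_derivative[OF assms(2)]) auto
  have contF: "continuous_on UNIV (F r)" for r
    unfolding F_def using assms(1)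
    by (intro continuous_intros continuous_on_cmod_powr continuous_on_compose2[OF contN]) auto
  \<comment> \<open>For \<open>r > 1/2\<close> all dilates of \<open>N\<close> are supported in one ball, hence in one box, over which
    differentiation under the integral is legitimate.\<close>
  obtain a b :: complex where ab: "cball 0 (2 * \<bar>R\<bar>) \<subseteq> cbox a b"
    using bounded_subset_cbox_symmetric[OF bounded_cball] by metis
  have supp: "N (r *\<^sub>R z) = 0" if "r \<in> U" "2 * \<bar>R\<bar> \<le> cmod z" for r z
  proof -
    have "1/2 * (2 * \<bar>R\<bar>) \<le> r * cmod z" using that by (intro mult_mono) (auto simp: U_def)
    then show ?thesis using that by (intro assms(3)) (auto simp: U_def)
  qed
  have U: "1 \<in> U" "convex U" "open U" by (auto simp: U_def)
  have const: "integral (cbox a b) (F r) = (LINT z|lborel. cmod (N z) powr p)" if r: "r \<in> U" for r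
  proof -
    have "integral (cbox a b) (F r) = (LINT z|lborel. F r z)"
      using supp[OF r] assms(1) by (intro compact_support_integral_cbox[OF contF _ ab]) (auto simp: F_def)
    also have "\<dots> = (LINT z|lborel. cmod (N z) powr p)"
      unfolding F_def
      by (rule integral_dilation)
         (use r in \<open>auto simp: U_def intro!: borel_measurable_continuous_onI continuous_on_cmod_powr assms contN\<close>)
    finally show ?thesis .
  qed
  have "((\<lambda>r. integral (cbox a b) (F r)) has_real_derivative integral (cbox a b) (F' 1)) (at 1 within U)"
  proof (rule leibniz_rule_field_derivative[OF derF _ _ U(1,2)])
    show "F r integrable_on cbox a b" for r
      by (intro integrable_continuous continuous_on_subset[OF contF]) auto
    show "continuous_on (U \<times> cbox a b) (\<lambda>(x, y). F' x y)"
      unfolding split_beta by (intro contF' continuous_intros)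
  qed
  then have "((\<lambda>r. integral (cbox a b) (F r)) has_real_derivative integral (cbox a b) (F' 1)) (at 1)"
    using U at_within_open by metis
  moreover have "((\<lambda>r. integral (cbox a b) (F r)) has_real_derivative 0) (at 1)"
  proof (rule DERIV_cong_ev[THEN iffD2, OF refl _ refl])
    show "\<forall>\<^sub>F r in nhds 1. integral (cbox a b) (F r) = (LINT z|lborel. cmod (N z) powr p)"
      using const U eventually_nhds_in_open[of U 1] by (auto elim: eventually_mono)
  qed simp
  ultimately have "integral (cbox a b) (F' 1) = 0" by (rule DERIV_unique)
  moreover have "integral (cbox a b) (F' 1) = (LINT z|lborel. F' 1 z)"
    using supp[OF U(1)] assms(1)
    by (intro compact_support_integral_cbox[OF _ _ ab] contF' continuous_intros) (auto simp: F'_def dW_def)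
  ultimately show ?thesis by (simp add: F'_def dW_def euler_op_def)
qed

lemma continuous_on_euler_op: "Ck (Suc k) N \<Longrightarrow> continuous_on UNIV (euler_op N)"
  unfolding euler_op_def[abs_def] by (intro continuous_on_frechet_derivative continuous_intros)

lemma euler_op_outside_support:
  assumes "\<And>z. R \<le> cmod z \<Longrightarrow> N z = 0" "R < cmod z"
  shows "euler_op N z = 0"
proof -
  have "((\<lambda>_. 0) has_derivative (\<lambda>_. 0)) (at z)" by simp
  then have "(N has_derivative (\<lambda>_. 0)) (at z)"
  proof (rule has_derivative_transform_within_open)
    show "open (- cball 0 R :: complex set)" by auto
  qed (use assms in \<open>auto simp: dist_norm\<close>)
  from frechet_derivative_at[OF this] show ?thesis by (metis euler_op_def)
qed

lemma euler_op_bound: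
  fixes p k :: real
  assumes "1 < p" "k = max p (p / (p - 1)) - 1" "Ck (Suc j) N" "\<And>z. R \<le> cmod z \<Longrightarrow> N z = 0"
  shows "(LINT z|lborel. cmod (euler_op N z) powr p) \<le> k powr p * (LINT z|lborel. cmod (2 * N z + euler_op N z) powr p)"
proof -
  obtain c where c: "\<And>m y :: complex. c * (cmod m powr p + p * (cmod m powr (p - 2) * Re (cnj m * y)))
                       \<le> k powr p * cmod (m + y) powr p - cmod y powr p"
    using pointwise_bound[OF assms(1,2)] by blast
  \<comment> \<open>The pointwise inequality is applied to \<open>m = 2N\<close> and \<open>y = E N\<close>; as \<open>E m = 2y\<close>, its right side is
    \<open>c/2\<close> times the divergence \<open>G\<close>.\<close>
  define M where "M = (\<lambda>z. 2 * N z)"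
  have CM: "Ck (Suc j) M" unfolding M_def using assms(3) by (intro Ck_mult Ck_const)
  have EM: "euler_op M z = 2 * euler_op N z" for z
  proof -
    have "(M has_derivative (\<lambda>v. 2 * frechet_derivative N (at z) v)) (at z)"
      unfolding M_def by (intro has_derivative_mult_right Ck_has_derivative[OF assms(3)])
    from frechet_derivative_at[OF this] show ?thesis by (metis euler_op_def)
  qed
  have supp: "N z = 0" "euler_op N z = 0" if "R + 1 \<le> cmod z" for z
    using that assms(4) euler_op_outside_support[of R N z] by auto
  have contN: "continuous_on UNIV N" and contE: "continuous_on UNIV (euler_op N)"
    using Ck_continuous[OF assms(3)] continuous_on_euler_op[OF assms(3)] by auto
  define G :: "complex \<Rightarrow> real" where "G = (\<lambda>z. 2 * cmod (M z) powr p + p * (cmod (M z) powr (p - 2) * Re (cnj (M z) * euler_op M z)))"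
  have "G = (\<lambda>z. 2 * cmod (M z) powr p + p * Re (of_real (cmod (M z) powr (p - 2)) * cnj (M z) * euler_op M z))"
    by (auto simp: G_def mult.assoc)
  moreover have "continuous_on UNIV \<dots>"
    unfolding M_def EM[unfolded M_def]
    by (intro continuous_intros continuous_on_cmod_powr continuous_on_compose2[OF contN] contE
         continuous_on_compose2[OF continuous_on_cmod_powr_weight[OF assms(1)]] assms(1)) auto
  ultimately have contG: "continuous_on UNIV G" by simp
  have intE: "integrable lborel (\<lambda>z. cmod (euler_op N z) powr p)"
    using assms(1) supp
    by (intro compact_support_integrable[where R="R + 1"] continuous_on_cmod_powr contE) auto
  have intS: "integrable lborel (\<lambda>z. cmod (2 * N z + euler_op N z) powr p)"
    using assms(1) supp
    by (intro compact_support_integrable[where R="R + 1"] continuous_on_cmod_powr continuous_intros contE contN) auto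
  have intG: "integrable lborel G"
    using assms(1) supp
    by (intro compact_support_integrable[where R="R + 1"] contG) (auto simp: G_def M_def)
  have "(LINT z|lborel. c / 2 * G z) \<le> (LINT z|lborel. k powr p * cmod (2 * N z + euler_op N z) powr p - cmod (euler_op N z) powr p)"
  proof (rule integral_mono)
    show "integrable lborel (\<lambda>z. c / 2 * G z)" using intG by simp
    show "integrable lborel (\<lambda>z. k powr p * cmod (2 * N z + euler_op N z) powr p - cmod (euler_op N z) powr p)"
      using intE intS by simp
    fix z
    have "c / 2 * G z = c * (cmod (M z) powr p + p * (cmod (M z) powr (p - 2) * Re (cnj (M z) * euler_op N z)))"
      by (simp add: G_def EM algebra_simps)
    also have "\<dots> \<le> k powr p * cmod (M z + euler_op N z) powr p - cmod (euler_op N z) powr p" by (rule c)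
    finally show "c / 2 * G z \<le> k powr p * cmod (2 * N z + euler_op N z) powr p - cmod (euler_op N z) powr p"
      by (simp add: M_def)
  qed
  moreover have "(LINT z|lborel. G z) = 0"
    using integral_radial_divergence[OF assms(1) CM, of R] assms(4) by (simp add: G_def M_def)
  ultimately show ?thesis using intE intS by simp
qed


section \<open>From mean zero to arbitrary radial functions\<close>

text \<open>This replaces the triangle inequality of \<open>L\<^sup>p\<close>: the first constant tends to \<open>1\<close> as
  \<open>e\<close> tends to \<open>0\<close>, and the second multiplies a term that is made small beforehand. It is convexity
  of the power function with weights \<open>1 - e\<close> and \<open>e\<close>.\<close>

lemma cmod_add_powr_le:
  fixes p e :: real
  assumes "1 \<le> p" "0 < e" "e < 1"
  shows "cmod (a + b) powr p \<le> (1 - e) powr (1 - p) * cmod a powr p + e powr (1 - p) * cmod b powr p"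
proof -
  have w: "u * (x / u) powr p = u powr (1 - p) * x powr p" if "0 < u" "0 \<le> x" for u x :: real
    using that by (simp add: powr_divide powr_diff)
  have "cmod (a + b) powr p \<le> ((1 - e) * (cmod a / (1 - e)) + e * (cmod b / e)) powr p"
    using assms norm_triangle_ineq[of a b] by (intro powr_mono2) auto
  also have "\<dots> \<le> (1 - e) * (cmod a / (1 - e)) powr p + e * (cmod b / e) powr p"
    using assms by (intro powr_convex_combination) auto
  finally show ?thesis using assms by (simp only: w norm_ge_zero)
qed

lemma test_function_bounded_support:
  assumes "test_function f"
  obtains R where "\<And>z. R \<le> cmod z \<Longrightarrow> f z = 0"
proof -
  have "bounded (closure {z. f z \<noteq> 0})"
    using assms compact_imp_bounded by (auto simp: test_function_def)
  then obtain R where R: "\<And>z. f z \<noteq> 0 \<Longrightarrow> cmod z \<le> R"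
    unfolding bounded_iff using closure_subset by (metis (mono_tags, lifting) mem_Collect_eq subsetD)
  show thesis
    by (rule that[of "\<bar>R\<bar> + 1"]) (use R in fastforce)
qed

lemma test_functionI:
  assumes "\<And>k. Ck k f" "\<And>z. R \<le> cmod z \<Longrightarrow> f z = 0"
  shows "test_function f"
proof -
  have "{z. f z \<noteq> 0} \<subseteq> cball 0 R" using assms(2) by (auto simp: not_le intro: less_imp_le) (metis linorder_le_cases)
  then have "bounded {z. f z \<noteq> 0}" using bounded_cball bounded_subset by blast
  then show ?thesis using assms(1) by (simp add: test_function_def compact_closure)
qed

lemma continuous_in_Lp:
  assumes "1 < p" "continuous_on UNIV f" "\<And>z. R \<le> cmod z \<Longrightarrow> f z = 0"
  shows "f \<in> Lp p"
  unfolding Lp_def using assms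
  by (auto intro!: borel_measurable_continuous_onI compact_support_integrable[where R=R] continuous_on_cmod_powr)

text \<open>Outside the support of \<open>f(lz)\<close> the ray means of \<open>f\<close> and of \<open>l\<^sup>2 f(lz)\<close> coincide, so the ray mean \<open>N\<close>
  of the difference has compact support. Hence \<open>cnj z * N(z)\<close> is a test function, on whose image
  under \<open>dbar\<close> the operator \<open>T\<close> is known.\<close>

lemma radial_mean_zero_bound:
  fixes p l :: real
  assumes "1 < p" "ahlfors_beurling p T" "test_function f" "radial f" "0 < l" "l < 1"
  defines "fl \<equiv> \<lambda>z. f z - of_real (l\<^sup>2) * f (l *\<^sub>R z)"
  shows "(LINT z|lborel. cmod (T fl z) powr p)
           \<le> (max p (p / (p - 1)) - 1) powr p * (LINT z|lborel. cmod (fl z) powr p)"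
proof -
  obtain R where R: "\<And>z. R \<le> cmod z \<Longrightarrow> f z = 0"
    using test_function_bounded_support[OF assms(3)] by blast
  have Cf: "Ck k f" for k using assms(3) by (simp add: test_function_def)
  have fl_alt: "fl = (\<lambda>z. f z + - of_real (l\<^sup>2) * f (l *\<^sub>R z))"
    by (auto simp: fl_def)
  have Cfl: "Ck k fl" for k
    unfolding fl_alt by (intro Ck_add Ck_mult Ck_const Ck_dilation Cf)
  define N where "N = ray_mean 1 fl"
  have CN: "Ck k N" for k unfolding N_def by (intro Ck_ray_mean Cfl)
  have N_alt: "N z = ray_mean 1 f z - of_real (l\<^sup>2) * ray_mean 1 f (l *\<^sub>R z)" for z
  proof -
    have 1: "(\<lambda>s. of_real (s ^ 1) * f (s *\<^sub>R z)) integrable_on {0..1}" for z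
      by (intro integrable_continuous_interval continuous_intros
            continuous_on_compose2[OF Ck_continuous[OF Cf]]) auto
    have "N z = integral {0..1} (\<lambda>s. of_real (s ^ 1) * f (s *\<^sub>R z) - of_real (l\<^sup>2) * (of_real (s ^ 1) * f (s *\<^sub>R (l *\<^sub>R z))))"
      by (simp add: N_def ray_mean_def fl_def algebra_simps)
    also have "\<dots> = integral {0..1} (\<lambda>s. of_real (s ^ 1) * f (s *\<^sub>R z)) - integral {0..1} (\<lambda>s. of_real (l\<^sup>2) * (of_real (s ^ 1) * f (s *\<^sub>R (l *\<^sub>R z))))"
      by (intro integral_diff 1 integrable_on_mult_right)
    finally show ?thesis by (simp add: ray_mean_def)
  qed
  have supp: "N z = 0" if "R / l \<le> cmod z" for z
  proof -
    have "R \<le> l * cmod z" using that assms(5) by (simp add: field_simps)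
    then have "of_real (l\<^sup>2) * ray_mean 1 f (l *\<^sub>R z) = ray_mean 1 f z"
      using R assms(5,6) by (intro ray_mean_outside_support[OF Cf]) auto
    then show ?thesis by (simp only: N_alt) simp
  qed
  have rad: "radial N"
  proof -
    have f: "f z = f (of_real (cmod z))" for z using assms(4) unfolding radial_def by blast
    have "fl z = fl (of_real (cmod z))" for z
    proof -
      have "f (l *\<^sub>R z) = f (l *\<^sub>R of_real (cmod z))"
        using assms(5) by (subst (1 2) f) simp
      then show ?thesis using f[of z] by (simp add: fl_def)
    qed
    then show ?thesis unfolding N_def by (intro radial_ray_mean) (auto simp: radial_def)
  qed
  define \<phi> where "\<phi> = (\<lambda>z. cnj z * N z)"
  have "test_function \<phi>"
    unfolding \<phi>_def
  proof (rule test_functionI)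
    show "Ck k (\<lambda>z. cnj z * N z)" for k
      by (intro Ck_mult CN Ck_bounded_linear bounded_linear_cnj)
    show "R / l \<le> cmod z \<Longrightarrow> cnj z * N z = 0" for z by (simp add: supp)
  qed
  then have AE: "AE z in lborel. T (dbar_op \<phi>) z = d_op \<phi> z"
    using assms(2) by (simp add: ahlfors_beurling_def)
  have diff: "N differentiable (at z)" for z using CN[of "Suc 0"] by simp
  have sol: "2 * N z + euler_op N z = fl z" for z
    using ray_mean_solves_euler[OF Cfl] by (simp add: N_def)
  have dbar: "dbar_op \<phi> = fl"
    unfolding \<phi>_def using ops_of_conj_times_radial(1)[OF rad diff] sol by auto
  have d: "cmod (d_op \<phi> z) = cmod (euler_op N z)" for z
    unfolding \<phi>_def by (rule ops_of_conj_times_radial(2)[OF rad diff])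
  have "fl \<in> Lp p"
    using sol supp euler_op_outside_support[of "R / l" N]
    by (intro continuous_in_Lp[of p fl "R / l + 1"] assms(1) Ck_continuous[OF Cfl])
       (simp add: sol[symmetric])
  then have "T fl \<in> Lp p"
    using assms(2) by (simp add: ahlfors_beurling_def bounded_linear_Lp_def)
  then have m: "T fl \<in> borel_measurable lborel" by (simp add: Lp_def)
  have cE: "continuous_on UNIV (euler_op N)" by (rule continuous_on_euler_op[OF CN])
  have "(LINT z|lborel. cmod (T fl z) powr p) = (LINT z|lborel. cmod (euler_op N z) powr p)"
  proof (rule integral_cong_AE)
    show "(\<lambda>z. cmod (T fl z) powr p) \<in> borel_measurable lborel"
      using m by measurable
    show "(\<lambda>z. cmod (euler_op N z) powr p) \<in> borel_measurable lborel"
      using continuous_on_cmod_powr[OF assms(1) cE] borel_measurable_continuous_onI by simp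
    show "AE z in lborel. cmod (T fl z) powr p = cmod (euler_op N z) powr p"
      using AE unfolding dbar by eventually_elim (simp add: d)
  qed
  also have "\<dots> \<le> (max p (p / (p - 1)) - 1) powr p * (LINT z|lborel. cmod (2 * N z + euler_op N z) powr p)"
    by (rule euler_op_bound[OF assms(1) refl CN[of "Suc 0"] supp])
  finally show ?thesis by (simp add: sol)
qed

lemma Lp_norm_powr:
  assumes "0 < p"
  shows "Lp_norm p f powr p = (LINT z|lborel. cmod (f z) powr p)"
  using assms by (simp add: Lp_norm_def powr_powr)

text \<open>The power \<open>l\<^bsup>2p\<^esup>\<close> of the amplitude outweighs the factor \<open>l\<^bsup>-2\<^esup>\<close> by which the support grows in area. This
  is where \<open>p > 1\<close> makes the correction negligible as \<open>l\<close> tends to \<open>0\<close>.\<close>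

lemma integral_dilation_powr:
  fixes f :: "complex \<Rightarrow> complex" and p l :: real
  assumes "1 < p" "0 < l" "continuous_on UNIV f"
  shows "(LINT z|lborel. cmod (of_real (l\<^sup>2) * f (l *\<^sub>R z)) powr p)
    = l powr (2 * p - 2) * (LINT z|lborel. cmod (f z) powr p)"
proof -
  have "cmod (of_real (l\<^sup>2) * f (l *\<^sub>R z)) powr p = l powr (2 * p - 2) * (l\<^sup>2 * cmod (f (l *\<^sub>R z)) powr p)" for z
  proof -
    have "l\<^sup>2 powr p = l powr (2 * p)"
      using assms(2) powr_powr[of l 2 p] by simp
    also have "\<dots> = l powr (2 * p - 2) * l\<^sup>2"
      using assms(2) powr_add[of l "2 * p - 2" 2] by simp
    finally show ?thesis by (simp add: norm_mult norm_power powr_mult)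
  qed
  then have "(LINT z|lborel. cmod (of_real (l\<^sup>2) * f (l *\<^sub>R z)) powr p)
     = l powr (2 * p - 2) * (LINT z|lborel. l\<^sup>2 * cmod (f (l *\<^sub>R z)) powr p)"
    by simp
  also have "(LINT z|lborel. l\<^sup>2 * cmod (f (l *\<^sub>R z)) powr p) = (LINT z|lborel. cmod (f z) powr p)"
    by (rule integral_dilation[OF assms(2)])
       (intro borel_measurable_continuous_onI continuous_on_cmod_powr assms)
  finally show ?thesis .
qed

theorem mainTheorem1:
  fixes p :: real
    and T :: "(complex \<Rightarrow> complex) \<Rightarrow> complex \<Rightarrow> complex"
    and f :: "complex \<Rightarrow> complex"
  assumes "1 < p"
    and "ahlfors_beurling p T"
    and "test_function f"
    and "radial f"
  shows "(LINT z|lborel. cmod (T f z) powr p)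
           \<le> (max p (p / (p - 1)) - 1) powr p * (LINT z|lborel. cmod (f z) powr p)"
proof -
  define K where "K = (max p (p / (p - 1)) - 1) powr p"
  define J where "J = (LINT z|lborel. cmod (f z) powr p)"
  have p: "1 < p" by (rule assms(1))
  have K: "0 \<le> K" by (simp add: K_def)
  obtain R where R: "\<And>z. R \<le> cmod z \<Longrightarrow> f z = 0"
    using test_function_bounded_support[OF assms(3)] by blast
  have cf: "continuous_on UNIV f"
    using assms(3) Ck_continuous by (auto simp: test_function_def)
  have T: "bounded_linear_Lp p T"
    using assms(2) by (simp add: ahlfors_beurling_def)
  obtain C where C: "\<And>g. g \<in> Lp p \<Longrightarrow> Lp_norm p (T g) \<le> C * Lp_norm p g"
    using T unfolding bounded_linear_Lp_def by blast
  have T_in: "T g \<in> Lp p" if "g \<in> Lp p" for g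
    using T that by (simp add: bounded_linear_Lp_def)
  have T_add: "AE z in lborel. T (\<lambda>w. g w + h w) z = T g z + T h z" if "g \<in> Lp p" "h \<in> Lp p" for g h
    using T that by (simp add: bounded_linear_Lp_def)
  have int: "integrable lborel (\<lambda>z. cmod (g z) powr p)" if "g \<in> Lp p" for g
    using that by (auto simp: Lp_def)
  have quasi: "(LINT z|lborel. cmod (h z) powr p)
      \<le> (1 - e) powr (1 - p) * (LINT z|lborel. cmod (a z) powr p) + e powr (1 - p) * (LINT z|lborel. cmod (b z) powr p)"
    if "0 < e" "e < 1" "a \<in> Lp p" "b \<in> Lp p" "h \<in> Lp p" "AE z in lborel. h z = a z + b z" for e a b h
  proof -
    have "(LINT z|lborel. cmod (h z) powr p) \<le>
        (LINT z|lborel. (1 - e) powr (1 - p) * cmod (a z) powr p + e powr (1 - p) * cmod (b z) powr p)"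
    proof (rule integral_mono_AE)
      show "AE z in lborel. cmod (h z) powr p \<le> (1 - e) powr (1 - p) * cmod (a z) powr p + e powr (1 - p) * cmod (b z) powr p"
        using that(6) by eventually_elim (use that p in \<open>simp add: cmod_add_powr_le\<close>)
    qed (use that in \<open>auto intro!: int integrable_add integrable_mult_right\<close>)
    then show ?thesis using that by (simp add: int)
  qed
  \<comment> \<open>\<open>f = g + h\<close> with \<open>g\<close> of integral zero and \<open>h\<close> small; the loss is controlled by \<open>e\<close> and \<open>l\<close>, and
    first \<open>l\<close>, then \<open>e\<close>, tends to \<open>0\<close>.\<close>
  have step: "(LINT z|lborel. cmod (T f z) powr p)
     \<le> (1 - e) powr (1 - p) * (K * ((1 - e) powr (1 - p) * J + e powr (1 - p) * (l powr (2 * p - 2) * J)))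
       + e powr (1 - p) * (\<bar>C\<bar> powr p * (l powr (2 * p - 2) * J))"
    if e: "0 < e" "e < 1" and l: "0 < l" "l < 1" for e l
  proof -
    define h where "h = (\<lambda>z. of_real (l\<^sup>2) * f (l *\<^sub>R z))"
    define g where "g = (\<lambda>z. f z - of_real (l\<^sup>2) * f (l *\<^sub>R z))"
    have far: "f z = 0 \<and> f (l *\<^sub>R z) = 0" if "R / l \<le> cmod z" for z
    proof -
      have "R \<le> l * cmod z" using that l by (simp add: field_simps)
      moreover have "l * cmod z \<le> 1 * cmod z" using l by (intro mult_right_mono) auto
      ultimately show ?thesis using l by (intro conjI R) auto
    qed
    have fL: "f \<in> Lp p" using continuous_in_Lp[OF p cf R] .
    have hL: "h \<in> Lp p" and gL: "g \<in> Lp p"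
      unfolding h_def g_def using far
      by (intro continuous_in_Lp[where R="R / l"] p continuous_intros continuous_on_compose2[OF cf]; simp)+
    have f_split: "f = (\<lambda>w. g w + h w)" by (simp add: g_def h_def)
    have hJ: "(LINT z|lborel. cmod (h z) powr p) = l powr (2 * p - 2) * J"
      unfolding h_def J_def by (rule integral_dilation_powr[OF p l(1) cf])
    have gJ: "(LINT z|lborel. cmod (g z) powr p) \<le> (1 - e) powr (1 - p) * J + e powr (1 - p) * (l powr (2 * p - 2) * J)"
    proof -
      have mh: "(\<lambda>z. - h z) \<in> Lp p" using hL by (auto simp: Lp_def)
      have "AE z in lborel. g z = f z + - h z" by (simp add: f_split)
      from quasi[OF e fL mh gL this] show ?thesis by (simp add: hJ J_def)
    qed
    have Th: "(LINT z|lborel. cmod (T h z) powr p) \<le> \<bar>C\<bar> powr p * (l powr (2 * p - 2) * J)"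
    proof -
      have nonneg: "0 \<le> Lp_norm p u" for u by (simp add: Lp_norm_def)
      have "Lp_norm p (T h) \<le> \<bar>C\<bar> * Lp_norm p h"
        using C[OF hL] mult_right_mono[OF abs_ge_self nonneg, of C h] by linarith
      then have "Lp_norm p (T h) powr p \<le> (\<bar>C\<bar> * Lp_norm p h) powr p"
        using p nonneg by (intro powr_mono2) auto
      then show ?thesis
        using p by (simp add: Lp_norm_powr powr_mult nonneg hJ)
    qed
    have Tg: "(LINT z|lborel. cmod (T g z) powr p) \<le> K * (LINT z|lborel. cmod (g z) powr p)"
      unfolding g_def K_def by (rule radial_mean_zero_bound[OF assms l])
    have "AE z in lborel. T f z = T g z + T h z"
      using T_add[OF gL hL] by (simp add: f_split[symmetric])
    then have "(LINT z|lborel. cmod (T f z) powr p) \<le> (1 - e) powr (1 - p) * (LINT z|lborel. cmod (T g z) powr p)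
         + e powr (1 - p) * (LINT z|lborel. cmod (T h z) powr p)"
      by (intro quasi e T_in fL gL hL)
    also have "\<dots> \<le> (1 - e) powr (1 - p) * (K * (LINT z|lborel. cmod (g z) powr p))
         + e powr (1 - p) * (\<bar>C\<bar> powr p * (l powr (2 * p - 2) * J))"
      by (intro add_mono mult_left_mono Tg Th) auto
    also have "\<dots> \<le> (1 - e) powr (1 - p) * (K * ((1 - e) powr (1 - p) * J + e powr (1 - p) * (l powr (2 * p - 2) * J)))
         + e powr (1 - p) * (\<bar>C\<bar> powr p * (l powr (2 * p - 2) * J))"
      by (intro add_mono mult_left_mono gJ K) auto
    finally show ?thesis .
  qed
  have step2: "(LINT z|lborel. cmod (T f z) powr p) \<le> (1 - e) powr (1 - p) * (K * ((1 - e) powr (1 - p) * J))"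
    if e: "0 < e" "e < 1" for e
  proof (rule tendsto_lowerbound)
    have "((\<lambda>l. l powr (2 * p - 2)) \<longlongrightarrow> 0) (at_right 0)"
      by (rule tendsto_zero_powrI[of _ _ "\<lambda>_. 2 * p - 2"]) (use p in \<open>auto intro!: tendsto_eq_intros simp: eventually_at_filter\<close>)
    then show "((\<lambda>l. (1 - e) powr (1 - p) * (K * ((1 - e) powr (1 - p) * J + e powr (1 - p) * (l powr (2 * p - 2) * J)))
       + e powr (1 - p) * (\<bar>C\<bar> powr p * (l powr (2 * p - 2) * J))) \<longlongrightarrow>
       (1 - e) powr (1 - p) * (K * ((1 - e) powr (1 - p) * J))) (at_right 0)"
    proof -
      assume *: "((\<lambda>l. l powr (2 * p - 2)) \<longlongrightarrow> 0) (at_right 0)"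
      show ?thesis by (rule tendsto_eq_rhs, (rule tendsto_intros *)+) simp
    qed
    show "\<forall>\<^sub>F l in at_right 0. (LINT z|lborel. cmod (T f z) powr p)
     \<le> (1 - e) powr (1 - p) * (K * ((1 - e) powr (1 - p) * J + e powr (1 - p) * (l powr (2 * p - 2) * J)))
       + e powr (1 - p) * (\<bar>C\<bar> powr p * (l powr (2 * p - 2) * J))"
      by (rule eventually_mono[OF eventually_at_right_real[OF zero_less_one]]) (use step e in auto)
  qed simp
  have "(LINT z|lborel. cmod (T f z) powr p) \<le> K * J"
  proof (rule tendsto_lowerbound)
    show "((\<lambda>e. (1 - e) powr (1 - p) * (K * ((1 - e) powr (1 - p) * J))) \<longlongrightarrow> K * J) (at_right 0)"
      by (auto intro!: tendsto_eq_intros)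
    show "\<forall>\<^sub>F e in at_right 0. (LINT z|lborel. cmod (T f z) powr p)
        \<le> (1 - e) powr (1 - p) * (K * ((1 - e) powr (1 - p) * J))"
      by (rule eventually_mono[OF eventually_at_right_real[OF zero_less_one]]) (use step2 in auto)
  qed simp
  then show ?thesis by (simp add: K_def J_def)
qed

end
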